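(* Let $K$ be a field and let $X$ be a minimal subshift of positive entropy over a finite alphabet. Then the monomial algebra $A_X$ over $K$ is a projectively simple, graded algebra of exponential growth, all of whose modules are exhaustively amenable.
   Context: Algebras are associative and unital; modules are right modules by default. Let $\Sigma=\{x_1,\dots,x_d\}$ be a finite alphabet. A subshift $X\subseteq\Sigma^{\mathbb Z}$ is a non-empty closed, shift-invariant subset (product topology, $\Sigma$ discrete); it is minimal if it contains no non-empty proper subshift. A factor of $X$ is a finite word occurring as a contiguous subword of some element of $X$; the entropy of $X$ is $\lim_n\frac1n\log p_X(n)$, where $p_X(n)$ is the number of length-$n$ factors of $X$. The monomial algebra $A_X$ over $K$ is spanned by the finite factors of $X$ (including the empty word $1$), which form a basis, with multiplication given by concatenation, where a product of factors is set to be $0$ if the concatenated word is not a factor of $X$. It is graded by length of words. An infinite-dimensional graded algebra is projectively simple if its non-zero homogeneous (two-sided) ideals have finite codimension over the base field. A finitely generated algebra $A$ has exponential growth if $\dim_K V^n$ grows exponentially in $n$ (at least $\beta^n$ for some $\beta>1$ and all large $n$), for a finite-dimensional generating subspace $V\ni 1$. For a right $A$-module $M$, a finite-dimensional subspace $V\leq A$ and $\varepsilon>0$, a finite-dimensional subspace $L\leq M$ is $(V,\varepsilon)$-invariant if $\dim_K LV<(1+\varepsilon)\dim_K L$, where $LV$ is the span of all products $\ell v$, $\ell\in L$, $v\in V$. $M$ is exhaustively amenable if for every finite-dimensional $V\leq A$, every $\varepsilon>0$ and every finite-dimensional $W\leq M$ there is a $(V,\varepsilon)$-invariant subspace of $M$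 containing $W$. *)

theory Defs
  imports "HOL-Analysis.Function_Topology" "HOL-Library.Poly_Mapping"
begin

section \<open>Subshifts\<close>

definition shift :: "(int \<Rightarrow> 'a) \<Rightarrow> int \<Rightarrow> 'a" where
  "shift x = (\<lambda>i. x (i + 1))"

definition subshift :: "'a set \<Rightarrow> (int \<Rightarrow> 'a) set \<Rightarrow> bool" where
  "subshift \<Sigma> X \<longleftrightarrow> X \<noteq> {} \<and>
     closedin (product_topology (\<lambda>_. discrete_topology \<Sigma>) UNIV) X \<and> shift ` X = X"

definition minimal_subshift :: "'a set \<Rightarrow> (int \<Rightarrow> 'a) set \<Rightarrow> bool" where
  "minimal_subshift \<Sigma> X \<longleftrightarrow> subshift \<Sigma> X \<and> (\<forall>Y. subshift \<Sigma> Y \<and> Y \<subseteq> X \<longrightarrow> Y = X)"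

definition factors :: "(int \<Rightarrow> 'a) set \<Rightarrow> 'a list set" where
  "factors X = {w. \<exists>x\<in>X. \<exists>i. w = map (\<lambda>k. x (i + int k)) [0..<length w]}"

definition complexity :: "(int \<Rightarrow> 'a) set \<Rightarrow> nat \<Rightarrow> nat" where
  "complexity X n = card {w \<in> factors X. length w = n}"

text \<open>By Fekete's lemma the limit exists for every subshift over a finite alphabet.\<close>

definition entropy :: "(int \<Rightarrow> 'a) set \<Rightarrow> real" where
  "entropy X = lim (\<lambda>n. ln (real (complexity X n)) / real n)"


section \<open>Algebras and modules over a field\<close>

text \<open>
  Algebras and modules are subspaces of an ambient vector space, which may be the whole type.
  Multiplication and action are only constrained on these subspaces.
\<close>

context vector_space
begin

definition fin_dim_subspace :: "'b set \<Rightarrow> bool" where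
  "fin_dim_subspace S \<longleftrightarrow> (\<exists>B. finite B \<and> S = span B)"

definition span_prod :: "('b \<Rightarrow> 'c \<Rightarrow> 'b) \<Rightarrow> 'b set \<Rightarrow> 'c set \<Rightarrow> 'b set" where
  "span_prod p L V = span {p l v | l v. l \<in> L \<and> v \<in> V}"

end

locale algebra_over = vector_space scale
  for scale :: "'k::field \<Rightarrow> 'a::ab_group_add \<Rightarrow> 'a" +
  fixes A :: "'a set"
    and mult :: "'a \<Rightarrow> 'a \<Rightarrow> 'a"
    and one :: 'a
  assumes subspace_A: "subspace A"
    and one_closed: "one \<in> A"
    and mult_closed: "\<lbrakk>a \<in> A; b \<in> A\<rbrakk> \<Longrightarrow> mult a b \<in> A"
    and mult_assoc: "\<lbrakk>a \<in> A; b \<in> A; c \<in> A\<rbrakk> \<Longrightarrow> mult (mult a b) c = mult a (mult b c)"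
    and mult_one_left: "a \<in> A \<Longrightarrow> mult one a = a"
    and mult_one_right: "a \<in> A \<Longrightarrow> mult a one = a"
    and mult_add_left: "\<lbrakk>a \<in> A; b \<in> A; c \<in> A\<rbrakk> \<Longrightarrow> mult (a + b) c = mult a c + mult b c"
    and mult_add_right: "\<lbrakk>a \<in> A; b \<in> A; c \<in> A\<rbrakk> \<Longrightarrow> mult a (b + c) = mult a b + mult a c"
    and mult_scale_left: "\<lbrakk>a \<in> A; b \<in> A\<rbrakk> \<Longrightarrow> mult (scale r a) b = scale r (mult a b)"
    and mult_scale_right: "\<lbrakk>a \<in> A; b \<in> A\<rbrakk> \<Longrightarrow> mult a (scale r b) = scale r (mult a b)"
begin

definition ideal :: "'a set \<Rightarrow> bool" where
  "ideal I \<longleftrightarrow> subspace I \<and> I \<subseteq> A \<and> (\<forall>a\<in>A. \<forall>x\<in>I. mult a x \<in> I \<and> mult x a \<in> I)"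

text \<open>The quotient \<open>A / I\<close> is spanned by the images of finitely many elements.\<close>

definition finite_codim :: "'a set \<Rightarrow> bool" where
  "finite_codim I \<longleftrightarrow> (\<exists>F. finite F \<and> F \<subseteq> A \<and> A \<subseteq> span (I \<union> F))"

fun space_power :: "'a set \<Rightarrow> nat \<Rightarrow> 'a set" where
  "space_power V 0 = span {one}"
| "space_power V (Suc n) = span_prod mult (space_power V n) V"

definition generating_subspace :: "'a set \<Rightarrow> bool" where
  "generating_subspace V \<longleftrightarrow> fin_dim_subspace V \<and> V \<subseteq> A \<and> one \<in> V \<and> (\<Union>n. space_power V n) = A"

definition exponential_growth :: bool where
  "exponential_growth \<longleftrightarrow> (\<exists>V. generating_subspace V \<and>
     (\<exists>\<beta>>1. \<forall>\<^sub>F n in sequentially. \<beta> ^ n \<le> real (dim (space_power V n))))"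

end

locale graded_algebra = algebra_over scale A mult one
  for scale :: "'k::field \<Rightarrow> 'a::ab_group_add \<Rightarrow> 'a" and A mult one +
  fixes G :: "nat \<Rightarrow> 'a set"
  assumes subspace_G: "subspace (G n)"
    and G_subset: "G n \<subseteq> A"
    and direct_sum: "a \<in> A \<Longrightarrow>
      \<exists>!f. (\<forall>n. f n \<in> G n) \<and> finite {n. f n \<noteq> 0} \<and> a = (\<Sum>n | f n \<noteq> 0. f n)"
    and one_degree: "one \<in> G 0"
    and mult_degree: "\<lbrakk>a \<in> G m; b \<in> G n\<rbrakk> \<Longrightarrow> mult a b \<in> G (m + n)"
begin

definition homogeneous_ideal :: "'a set \<Rightarrow> bool" where
  "homogeneous_ideal I \<longleftrightarrow> ideal I \<and> I = span (\<Union>n. I \<inter> G n)"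

definition projectively_simple :: bool where
  "projectively_simple \<longleftrightarrow> \<not> fin_dim_subspace A \<and>
     (\<forall>I. homogeneous_ideal I \<and> I \<noteq> {0} \<longrightarrow> finite_codim I)"

end

locale right_module = A: algebra_over scale A mult one + M: vector_space scaleM
  for scale :: "'k::field \<Rightarrow> 'a::ab_group_add \<Rightarrow> 'a" and A mult one
    and scaleM :: "'k \<Rightarrow> 'm::ab_group_add \<Rightarrow> 'm" +
  fixes M :: "'m set"
    and act :: "'m \<Rightarrow> 'a \<Rightarrow> 'm"
  assumes subspace_M: "M.subspace M"
    and act_closed: "\<lbrakk>m \<in> M; a \<in> A\<rbrakk> \<Longrightarrow> act m a \<in> M"
    and act_one: "m \<in> M \<Longrightarrow> act m one = m"
    and act_mult: "\<lbrakk>m \<in> M; a \<in> A; b \<in> A\<rbrakk> \<Longrightarrow> act m (mult a b) = act (act m a) b"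
    and act_add_left: "\<lbrakk>m \<in> M; n \<in> M; a \<in> A\<rbrakk> \<Longrightarrow> act (m + n) a = act m a + act n a"
    and act_add_right: "\<lbrakk>m \<in> M; a \<in> A; b \<in> A\<rbrakk> \<Longrightarrow> act m (a + b) = act m a + act m b"
    and act_scale_left: "\<lbrakk>m \<in> M; a \<in> A\<rbrakk> \<Longrightarrow> act (scaleM r m) a = scaleM r (act m a)"
    and act_scale_right: "\<lbrakk>m \<in> M; a \<in> A\<rbrakk> \<Longrightarrow> act m (scale r a) = scaleM r (act m a)"
begin

definition invariant_subspace :: "'a set \<Rightarrow> real \<Rightarrow> 'm set \<Rightarrow> bool" where
  "invariant_subspace V \<epsilon> L \<longleftrightarrow> M.fin_dim_subspace L \<and> L \<subseteq> M \<and>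
     real (M.dim (M.span_prod act L V)) < (1 + \<epsilon>) * real (M.dim L)"

text \<open>
  The inequality is strict, so the zero subspace is never invariant and the zero module is not
  exhaustively amenable.
\<close>

definition exhaustively_amenable :: bool where
  "exhaustively_amenable \<longleftrightarrow>
     (\<forall>V \<epsilon> W. A.fin_dim_subspace V \<and> V \<subseteq> A \<and> \<epsilon> > 0 \<and> M.fin_dim_subspace W \<and> W \<subseteq> M \<longrightarrow>
        (\<exists>L. invariant_subspace V \<epsilon> L \<and> W \<subseteq> L))"

end


section \<open>The monomial algebra of a subshift\<close>

text \<open>
  Finitely supported functions on words are the vector space with basis the set of all words;
  the monomial algebra is the subspace spanned by the factors.
\<close>

definition word_scale :: "'k::field \<Rightarrow> ('a list \<Rightarrow>\<^sub>0 'k) \<Rightarrow> ('a list \<Rightarrow>\<^sub>0 'k)" where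
  "word_scale c f = Poly_Mapping.map ((*) c) f"

definition monomial_algebra :: "(int \<Rightarrow> 'a) set \<Rightarrow> ('a list \<Rightarrow>\<^sub>0 'k::field) set" where
  "monomial_algebra X = {f. Poly_Mapping.keys f \<subseteq> factors X}"

definition monomial_mult ::
  "(int \<Rightarrow> 'a) set \<Rightarrow> ('a list \<Rightarrow>\<^sub>0 'k::field) \<Rightarrow> ('a list \<Rightarrow>\<^sub>0 'k) \<Rightarrow> ('a list \<Rightarrow>\<^sub>0 'k)" where
  "monomial_mult X f g =
     (\<Sum>u\<in>Poly_Mapping.keys f. \<Sum>v\<in>Poly_Mapping.keys g.
        if u @ v \<in> factors X
        then Poly_Mapping.single (u @ v) (Poly_Mapping.lookup f u * Poly_Mapping.lookup g v)
        else 0)"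

definition monomial_one :: "'a list \<Rightarrow>\<^sub>0 'k::field" where
  "monomial_one = Poly_Mapping.single [] 1"

definition monomial_component :: "(int \<Rightarrow> 'a) set \<Rightarrow> nat \<Rightarrow> ('a list \<Rightarrow>\<^sub>0 'k::field) set" where
  "monomial_component X n = {f. Poly_Mapping.keys f \<subseteq> {w \<in> factors X. length w = n}}"

end

theory Submission
  imports Defs "HOL-Library.List_Lexorder" "HOL-Library.Sublist"
begin

text \<open>
  The proof rests on two properties of the language of a minimal subshift. By compactness it is
  uniformly recurrent: every factor occurs in all sufficiently long factors
  (\<open>uniform_recurrence\<close>). By a lexicographic argument, any finite non-empty set \<open>S\<close> of factors of
  equal length contains a word \<open>z\<close> that is isolated by a suitable prefix \<open>p\<close>: among the words in
  \<open>S\<close> only \<open>z\<close> may follow \<open>p\<close> (\<open>isolating_prefix\<close>).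

  \<^bold>\<open>Projective simplicity.\<close> Let \<open>f\<close> be a non-zero homogeneous element of an ideal. If \<open>p\<close> isolates a
  word \<open>z\<close> in the support of \<open>f\<close>, then \<open>p f\<close> is a non-zero multiple of the word \<open>p z\<close>. So the ideal
  contains a word, hence all long words, and has finite codimension.

  \<^bold>\<open>Growth.\<close> The powers of the space spanned by \<open>1\<close> and the letters have the words of bounded length as
  bases. By Fekete's lemma there are at least \<open>exp (n h)\<close> factors of length \<open>n\<close>, where \<open>h\<close> is the
  entropy.

  \<^bold>\<open>Amenability.\<close> Taking all factors of length \<open>N\<close> for \<open>S\<close>, one finds a word \<open>p\<close> whose prolongation
  by \<open>N\<close> letters is unique. Although the algebra grows exponentially, a subspace of \<open>M p\<close> therefore
  grows only linearly during the next \<open>N\<close> letters. If \<open>M p\<close> is infinite-dimensional, then the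
  subspace may be taken large compared with any given space \<open>W\<close>, and linear growth yields
  an almost invariant space that absorbs \<open>W\<close> (\<open>invariant_subspace_if_not_spanned\<close>). If instead \<open>M w\<close> is
  finite-dimensional for some factor \<open>w\<close>, then so is the image of \<open>M\<close> under all long words, because
  they contain \<open>w\<close> near their end, and every finite-dimensional subspace lies in a
  finite-dimensional submodule (\<open>invariant_subspace_if_spanned\<close>).
\<close>

section \<open>The language of a subshift\<close>

definition window :: "(int \<Rightarrow> 'a) \<Rightarrow> int \<Rightarrow> nat \<Rightarrow> 'a list" where
  "window x i n = map (\<lambda>k. x (i + int k)) [0..<n]"

lemma length_window [simp]: "length (window x i n) = n"
  by (simp add: window_def)

lemma window_eq_iff: "window x i (length w) = w \<longleftrightarrow> (\<forall>k<length w. x (i + int k) = w ! k)"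
  by (simp add: list_eq_iff_nth_eq) (simp add: window_def)

lemma window_append: "window x i (m + n) = window x i m @ window x (i + int m) n"
  by (rule nth_equalityI) (auto simp: window_def nth_append)

lemma factors_iff: "w \<in> factors X \<longleftrightarrow> (\<exists>x\<in>X. \<exists>i. window x i (length w) = w)"
  unfolding factors_def window_def by (simp only: mem_Collect_eq) (metis (no_types))

lemma window_in_factors: "x \<in> X \<Longrightarrow> window x i n \<in> factors X"
  unfolding factors_iff by (intro bexI[of _ x] exI[of _ i]) simp_all

lemma factors_append:
  assumes "u @ v \<in> factors X"
  shows "u \<in> factors X" "v \<in> factors X"
proof -
  obtain x i where x: "x \<in> X" "window x i (length u + length v) = u @ v"
    using assms by (auto simp: factors_iff)
  then have "window x i (length u) = u" "window x (i + int (length u)) (length v) = v"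
    by (simp_all add: window_append)
  then show "u \<in> factors X" "v \<in> factors X"
    using window_in_factors[OF x(1), of i "length u"]
      window_in_factors[OF x(1), of "i + int (length u)" "length v"] by simp_all
qed

lemma factor_extend:
  assumes "u \<in> factors X"
  obtains v where "u @ v \<in> factors X" "length v = n"
proof -
  obtain x i where x: "x \<in> X" "window x i (length u) = u"
    using assms by (auto simp: factors_iff)
  then have "u @ window x (i + int (length u)) n \<in> factors X"
    using window_in_factors[OF x(1), of i "length u + n"] by (simp add: window_append)
  then show thesis by (rule that) simp
qed

definition words :: "(int \<Rightarrow> 'a) set \<Rightarrow> nat \<Rightarrow> 'a list set" where
  "words X n = {w \<in> factors X. length w = n}"

lemma complexity_eq: "complexity X n = card (words X n)"
  by (simp add: complexity_def words_def)

locale finite_minimal_subshift =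
  fixes \<Sigma> :: "'a set" and X :: "(int \<Rightarrow> 'a) set"
  assumes finite_alphabet: "finite \<Sigma>"
    and minimal: "minimal_subshift \<Sigma> X"
begin

abbreviation "full_shift \<equiv> product_topology (\<lambda>_::int. discrete_topology \<Sigma>) UNIV"

lemma is_subshift: "subshift \<Sigma> X"
  using minimal by (simp add: minimal_subshift_def)

lemma closedin_X: "closedin full_shift X"
  and shift_X: "shift ` X = X"
  and nonempty: "X \<noteq> {}"
  using is_subshift by (simp_all add: subshift_def)

lemma letter_in_alphabet: "x \<in> X \<Longrightarrow> x i \<in> \<Sigma>"
  using closedin_subset[OF closedin_X] by (auto simp: PiE_def Pi_def)

lemma factors_alphabet:
  assumes "w \<in> factors X"
  shows "set w \<subseteq> \<Sigma>"
proof -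
  obtain x i where x: "x \<in> X" "window x i (length w) = w"
    using assms by (auto simp: factors_iff)
  have "set (window x i (length w)) \<subseteq> \<Sigma>"
    using letter_in_alphabet[OF x(1)] by (auto simp: window_def)
  with x(2) show ?thesis by simp
qed

lemma finite_words: "finite (words X n)"
  by (rule finite_subset[OF _ finite_lists_length_eq[OF finite_alphabet, of n]])
    (auto simp: words_def dest: factors_alphabet)

lemma finite_words_less: "finite {w \<in> factors X. length w < n}"
proof -
  have "{w \<in> factors X. length w < n} = (\<Union>k<n. words X k)"
    by (auto simp: words_def)
  then show ?thesis by (simp add: finite_words)
qed

lemma words_nonempty: "words X n \<noteq> {}"
proof -
  obtain x where "x \<in> X" using nonempty by auto
  then have "window x 0 n \<in> words X n" by (simp add: words_def window_in_factors)
  then show ?thesis by auto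
qed

lemma Nil_factor: "[] \<in> factors X"
  using words_nonempty[of 0] by (auto simp: words_def)

lemma translate_in_subshift:
  assumes "x \<in> X"
  shows "(\<lambda>i. x (i + t)) \<in> X"
proof -
  have up: "(\<lambda>i. y (i + int n)) \<in> X" if "y \<in> X" for y n
  proof (induction n)
    case (Suc n)
    then have "shift (\<lambda>i. y (i + int n)) \<in> X" using shift_X by blast
    then show ?case by (simp add: shift_def algebra_simps)
  qed (use that in simp)
  have down: "(\<lambda>i. y (i - int n)) \<in> X" if "y \<in> X" for y n
  proof (induction n)
    case (Suc n)
    have "(\<lambda>i. y (i - int n)) \<in> shift ` X" unfolding shift_X by (rule Suc)
    then obtain z where z: "z \<in> X" "shift z = (\<lambda>i. y (i - int n))" by (metis imageE)
    have "z i = y (i - int (Suc n))" for i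
      using fun_cong[OF z(2), of "i - 1"] by (simp add: shift_def algebra_simps)
    then have "(\<lambda>i. y (i - int (Suc n))) = z" by (simp add: fun_eq_iff)
    with z(1) show ?case by metis
  qed (use that in simp)
  show ?thesis
  proof (cases "t \<ge> 0")
    case True
    then show ?thesis using up[OF assms, of "nat t"] by simp
  next
    case False
    then show ?thesis using down[OF assms, of "nat (- t)"] by simp
  qed
qed

text \<open>
  Openness of the cylinders is what makes the set of all points avoiding a word closed, and what
  lets compactness bound the gaps between occurrences of a word.
\<close>
lemma openin_cylinder:
  "openin full_shift {x \<in> topspace full_shift. window x i (length w) = w}"
proof (cases "set w \<subseteq> \<Sigma>")
  case True
  define C where "C j = (if i \<le> j \<and> j < i + int (length w) then {w ! nat (j - i)} else \<Sigma>)" for j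
  have "openin full_shift (\<Pi>\<^sub>E j\<in>UNIV. C j)"
  proof (rule product_topology_basis)
    fix j show "openin (discrete_topology \<Sigma>) (C j)"
      using True nth_mem[of "nat (j - i)" w] by (auto simp: C_def)
    show "finite {j. C j \<noteq> topspace (discrete_topology \<Sigma>)}"
      by (rule finite_subset[of _ "{i..i + int (length w)}"]) (auto simp: C_def)
  qed
  also have "(\<Pi>\<^sub>E j\<in>UNIV. C j) = {x \<in> topspace full_shift. window x i (length w) = w}"
  proof (intro equalityI subsetI)
    fix x assume x: "x \<in> (\<Pi>\<^sub>E j\<in>UNIV. C j)"
    then have xC: "x j \<in> C j" for j by (auto simp: PiE_def Pi_def)
    have "C j \<subseteq> \<Sigma>" for j
      using True nth_mem[of "nat (j - i)" w] by (auto simp: C_def)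
    moreover have "x (i + int k) = w ! k" if "k < length w" for k
      using xC[of "i + int k"] that by (simp add: C_def)
    ultimately show "x \<in> {x \<in> topspace full_shift. window x i (length w) = w}"
      using xC by (auto simp: window_eq_iff PiE_def)
  next
    fix x assume x: "x \<in> {x \<in> topspace full_shift. window x i (length w) = w}"
    then have eq: "x (i + int k) = w ! k" if "k < length w" for k
      using that by (simp add: window_eq_iff)
    have "x j \<in> C j" for j
      using x eq[of "nat (j - i)"] by (auto simp: C_def PiE_def Pi_def)
    then show "x \<in> (\<Pi>\<^sub>E j\<in>UNIV. C j)" by (auto simp: PiE_def)
  qed
  finally show ?thesis .
next
  case False
  have "set (window x i n) \<subseteq> \<Sigma>" if "x \<in> topspace full_shift" for x n
    using that by (auto simp: window_def PiE_def Pi_def)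
  with False have "{x \<in> topspace full_shift. window x i (length w) = w} = {}"
    by (metis (mono_tags, lifting) empty_Collect_eq)
  then show ?thesis by (metis openin_empty)
qed

text \<open>
  The points of \<open>X\<close> that avoid \<open>w\<close> form a closed shift-invariant set. If it were non-empty, then
  it would be all of \<open>X\<close> by minimality, and \<open>w\<close> would not be a factor.
\<close>
lemma factor_occurs_everywhere:
  assumes "w \<in> factors X" "x \<in> X"
  shows "\<exists>i. window x i (length w) = w"
proof (rule ccontr)
  assume none: "\<nexists>i. window x i (length w) = w"
  define Y where "Y = {y \<in> X. \<forall>i. window y i (length w) \<noteq> w}"
  define U where "U = (\<Union>i. {x \<in> topspace full_shift. window x i (length w) = w})"
  have "openin full_shift U"
    unfolding U_def by (rule openin_Union) (use openin_cylinder in blast)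
  moreover have "Y = X - U"
    using closedin_subset[OF closedin_X] by (auto simp: Y_def U_def)
  ultimately have "closedin full_shift Y"
    using closedin_X by (simp add: closedin_diff)
  moreover have "shift ` Y = Y"
  proof -
    have win: "window (shift y) i n = window y (i + 1) n" for y :: "int \<Rightarrow> 'a" and i n
      by (simp add: window_def shift_def algebra_simps)
    have "shift y \<in> Y" if "y \<in> Y" for y
      using that shift_X by (auto simp: Y_def win)
    moreover have "y \<in> shift ` Y" if "y \<in> Y" for y
    proof -
      have "y \<in> shift ` X" unfolding shift_X using that by (simp add: Y_def)
      then obtain z where z: "z \<in> X" "y = shift z" by blast
      have "window z i (length w) \<noteq> w" for i
      proof -
        have "window (shift z) (i - 1) (length w) \<noteq> w" using that by (simp add: Y_def z(2))
        then show ?thesis by (simp add: win)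
      qed
      with z show ?thesis by (auto simp: Y_def)
    qed
    ultimately show ?thesis by blast
  qed
  moreover have "x \<in> Y" using none assms(2) by (simp add: Y_def)
  ultimately have "subshift \<Sigma> Y" by (auto simp: subshift_def)
  then have "Y = X" using minimal by (auto simp: minimal_subshift_def Y_def)
  moreover obtain y i where "y \<in> X" "window y i (length w) = w"
    using assms(1) by (auto simp: factors_iff)
  ultimately show False by (auto simp: Y_def)
qed

text \<open>
  The cylinders of \<open>w\<close> at the positions \<open>i\<close> cover \<open>X\<close> because \<open>w\<close> occurs in every point. By
  compactness finitely many positions suffice, say those with \<open>\<bar>i\<bar> \<le> r\<close>; translating a point, every
  window of length \<open>2 * r + length w\<close> then contains \<open>w\<close>.
\<close>
lemma uniform_recurrence:
  assumes "w \<in> factors X"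
  obtains R where "\<And>v. v \<in> factors X \<Longrightarrow> R \<le> length v \<Longrightarrow> sublist w v"
proof -
  define C where "C i = {x \<in> topspace full_shift. window x i (length w) = w}" for i
  have "compactin full_shift X"
    using closedin_X finite_alphabet
    by (auto intro!: closedin_compact_space
          simp: compact_space_product_topology compact_space_discrete_topology)
  moreover have "X \<subseteq> \<Union>(range C)"
    using factor_occurs_everywhere[OF assms] closedin_subset[OF closedin_X] by (auto simp: C_def)
  moreover have "\<forall>U\<in>range C. openin full_shift U"
    using openin_cylinder by (auto simp: C_def)
  ultimately obtain \<F> where "finite \<F>" "\<F> \<subseteq> range C" "X \<subseteq> \<Union>\<F>"
    unfolding compactin_def by meson
  then obtain I where I: "finite I" "X \<subseteq> \<Union>(C ` I)"
    by (metis finite_subset_image)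
  obtain r :: nat where r: "\<And>i. i \<in> I \<Longrightarrow> \<bar>i\<bar> \<le> int r"
  proof (rule that)
    fix i assume "i \<in> I"
    then have "nat \<bar>i\<bar> \<le> Max ((\<lambda>i. nat \<bar>i\<bar>) ` I)" using I(1) by simp
    then show "\<bar>i\<bar> \<le> int (Max ((\<lambda>i. nat \<bar>i\<bar>) ` I))" by linarith
  qed
  show thesis
  proof (rule that[of "2 * r + length w"])
    fix v assume v: "v \<in> factors X" "2 * r + length w \<le> length v"
    then obtain x j where x: "x \<in> X" "window x j (length v) = v"
      by (auto simp: factors_iff)
    have "(\<lambda>i. x (i + (j + int r))) \<in> X" using x(1) by (rule translate_in_subshift)
    then obtain i where i: "i \<in> I" "window (\<lambda>i. x (i + (j + int r))) i (length w) = w"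
      using I(2) by (auto simp: C_def)
    define a where "a = nat (i + int r)"
    have a: "int a = i + int r" "a + length w \<le> length v" using r[OF i(1)] v(2) by (auto simp: a_def)
    have "window x (j + int a) (length w) = w"
      using i(2) a(1) by (simp add: window_def algebra_simps)
    moreover have "length v = a + (length w + (length v - a - length w))" using a(2) by simp
    ultimately have "v = window x j a @ w @ window x (j + int a + int (length w)) (length v - a - length w)"
      using x(2) window_append[of x j a] window_append[of x "j + int a" "length w"] by metis
    then show "sublist w v" by (auto simp: sublist_def)
  qed
qed

text \<open>
  Both projective simplicity and amenability come down to this lemma: among given words of equal
  length, one can be singled out by what stands in front of it. Order the words
  lexicographically, let \<open>z\<close> be the largest element of \<open>S\<close>, and let \<open>w\<close> be the smallest factor of
  a length so large that \<open>z\<close> must occur in \<open>w = p @ z @ s\<close>. If \<open>p\<close> could be followed by some other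
  \<open>z' \<in> S\<close>, then, as factors can be prolonged, some \<open>p @ z' @ s'\<close> would be a factor of
  the same length as \<open>w\<close>, and smaller than \<open>w\<close> since \<open>z' < z\<close>.
\<close>
lemma isolating_prefix:
  assumes "finite S" "S \<noteq> {}" "S \<subseteq> words X n"
  obtains p z where "z \<in> S" "p @ z \<in> factors X"
    "\<And>z'. z' \<in> S \<Longrightarrow> p @ z' \<in> factors X \<Longrightarrow> z' = z"
proof -
  \<comment> \<open>The alphabet carries no order, so letters are compared through an injection into the naturals.\<close>
  obtain e :: "'a \<Rightarrow> nat" where e: "inj_on e \<Sigma>"
    using finite_imp_inj_to_nat_seg[OF finite_alphabet] by blast
  define code where "code = map e"
  have code_eq: "u = v" if "code u = code v" "u \<in> factors X" "v \<in> factors X" for u v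
  proof -
    have "inj_on e (set u \<union> set v)"
      using that(2,3) factors_alphabet by (intro inj_on_subset[OF e]) auto
    then show "u = v" using that(1) by (simp add: code_def inj_on_map_eq_map)
  qed
  obtain z where z: "z \<in> S" "\<And>v. v \<in> S \<Longrightarrow> code v \<le> code z"
  proof -
    have "Max (code ` S) \<in> code ` S" using assms(1,2) by (intro Max_in) auto
    then obtain z where "z \<in> S" "Max (code ` S) = code z" by blast
    then show thesis using assms(1) by (metis Max_ge finite_imageI imageI that)
  qed
  then have zF: "z \<in> factors X" "length z = n" using assms(3) by (auto simp: words_def)
  obtain R where R: "\<And>v. v \<in> factors X \<Longrightarrow> R \<le> length v \<Longrightarrow> sublist z v"
    using uniform_recurrence[OF zF(1)] by blast
  obtain w where w: "w \<in> words X R" "\<And>v. v \<in> words X R \<Longrightarrow> code w \<le> code v"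
  proof -
    have fin: "finite (code ` words X R)" by (simp add: finite_words)
    then have "Min (code ` words X R) \<in> code ` words X R"
      using words_nonempty by (intro Min_in) auto
    then obtain w where "w \<in> words X R" "Min (code ` words X R) = code w" by blast
    then show thesis using fin by (metis Min_le imageI that)
  qed
  obtain p s where ps: "w = p @ z @ s"
    using R[of w] w(1) by (auto simp: words_def sublist_def)
  show thesis
  proof (rule that[OF z(1), of p])
    show "p @ z \<in> factors X"
      using w(1) factors_append(1)[of "p @ z" s] by (simp add: words_def ps)
    fix z' assume z': "z' \<in> S" "p @ z' \<in> factors X"
    then have len: "length z' = length z" using assms(3) zF by (auto simp: words_def)
    obtain s' where s': "(p @ z') @ s' \<in> factors X" "length s' = length s"
      using factor_extend[OF z'(2)] by blast
    then have "p @ z' @ s' \<in> words X R" using w(1) len by (simp add: words_def ps)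
    then have "code (p @ z @ s) \<le> code (p @ z' @ s')" using w(2) ps by blast
    moreover have "code (p @ z' @ s') < code (p @ z @ s)" if "code z' < code z"
      using that len s'(2) unfolding list_less_def code_def
      by (simp add: lexord_append_leftI lexord_sufI)
    ultimately have "code z' = code z" using z(2)[OF z'(1)] by force
    then show "z' = z" using code_eq zF(1) factors_append(2)[OF z'(2)] by blast
  qed
qed

end

section \<open>The monomial algebra as a graded algebra\<close>

abbreviation word :: "'a list \<Rightarrow> ('a list \<Rightarrow>\<^sub>0 'k::field)" where
  "word u \<equiv> Poly_Mapping.single u 1"

lemma lookup_word_scale [simp]:
  "Poly_Mapping.lookup (word_scale c f) u = c * Poly_Mapping.lookup f u"
  by (simp add: word_scale_def Poly_Mapping.map.rep_eq when_def)

interpretation word_space: vector_space "word_scale :: 'k::field \<Rightarrow> ('a list \<Rightarrow>\<^sub>0 'k) \<Rightarrow> _"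
  by unfold_locales (auto intro!: poly_mapping_eqI simp: lookup_add algebra_simps)

lemma word_scale_single: "word_scale c (Poly_Mapping.single u a) = Poly_Mapping.single u (c * a)"
  by (rule poly_mapping_eqI) (simp add: lookup_single when_def)

lemma keys_word_scale: "Poly_Mapping.keys (word_scale c f) \<subseteq> Poly_Mapping.keys f"
  by (auto simp: in_keys_iff)

lemma sum_of_words:
  fixes f :: "'a list \<Rightarrow>\<^sub>0 'k::field"
  shows "(\<Sum>u\<in>Poly_Mapping.keys f. Poly_Mapping.single u (Poly_Mapping.lookup f u)) = f"
proof (rule poly_mapping_eqI)
  fix w
  have "(\<Sum>u\<in>Poly_Mapping.keys f. Poly_Mapping.lookup f u when u = w) =
      (if w \<in> Poly_Mapping.keys f then Poly_Mapping.lookup f w else 0)"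
    by (simp add: when_def sum.delta)
  then show "Poly_Mapping.lookup (\<Sum>u\<in>Poly_Mapping.keys f. Poly_Mapping.single u (Poly_Mapping.lookup f u)) w
      = Poly_Mapping.lookup f w"
    by (simp add: lookup_sum lookup_single in_keys_iff)
qed

text \<open>
  Identities between multilinear expressions need only be checked on scalar multiples of words.
\<close>
lemma additive_word_induct [case_names zero single add]:
  fixes f :: "'a list \<Rightarrow>\<^sub>0 'k::field"
  assumes "P 0" "\<And>u c. P (Poly_Mapping.single u c)" "\<And>f g. P f \<Longrightarrow> P g \<Longrightarrow> P (f + g)"
  shows "P f"
proof -
  have "P (\<Sum>u\<in>U. Poly_Mapping.single u (Poly_Mapping.lookup f u))" if "finite U" for U
    using that by induction (simp_all add: assms)
  then show ?thesis using sum_of_words[of f] by (metis finite_keys)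
qed

text \<open>
  Every subspace of words that occurs below is of this form: the algebra itself, its homogeneous
  components and the powers of the standard generating space.
\<close>
definition supported :: "'a list set \<Rightarrow> ('a list \<Rightarrow>\<^sub>0 'k::field) set" where
  "supported S = {f. Poly_Mapping.keys f \<subseteq> S}"

lemma monomial_algebra_eq: "monomial_algebra X = supported (factors X)"
  by (simp add: monomial_algebra_def supported_def)

lemma monomial_component_eq: "monomial_component X n = supported (words X n)"
  by (simp add: monomial_component_def supported_def words_def)

lemma word_in_supported: "u \<in> S \<Longrightarrow> word u \<in> supported S"
  by (simp add: supported_def)

lemma supported_mono: "S \<subseteq> T \<Longrightarrow> supported S \<subseteq> supported T"
  by (auto simp: supported_def)

lemma subspace_supported:
  "word_space.subspace (supported S :: ('a list \<Rightarrow>\<^sub>0 'k::field) set)"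
proof (rule word_space.subspaceI)
  show "f + g \<in> supported S" if "f \<in> supported S" "g \<in> supported S"
    for f g :: "'a list \<Rightarrow>\<^sub>0 'k::field"
    using that Poly_Mapping.keys_add[of f g] by (auto simp: supported_def)
  show "word_scale c f \<in> supported S" if "f \<in> supported S" for c and f :: "'a list \<Rightarrow>\<^sub>0 'k::field"
    using that keys_word_scale[of c f] by (auto simp: supported_def)
qed (simp add: supported_def)

lemma span_words:
  "word_space.span (word ` S) = (supported S :: ('a list \<Rightarrow>\<^sub>0 'k::field) set)"
proof (intro equalityI subsetI)
  fix f assume "f \<in> word_space.span (word ` S :: ('a list \<Rightarrow>\<^sub>0 'k) set)"
  moreover have "word_space.span (word ` S) \<subseteq> (supported S :: ('a list \<Rightarrow>\<^sub>0 'k) set)"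
    by (rule word_space.span_minimal) (auto intro: word_in_supported subspace_supported)
  ultimately show "f \<in> supported S" by blast
next
  fix f :: "'a list \<Rightarrow>\<^sub>0 'k" assume f: "f \<in> supported S"
  have "(\<Sum>u\<in>Poly_Mapping.keys f. word_scale (Poly_Mapping.lookup f u) (word u))
      \<in> word_space.span (word ` S)"
    using f by (intro word_space.span_sum word_space.span_scale word_space.span_base)
      (auto simp: supported_def)
  then show "f \<in> word_space.span (word ` S)"
    by (simp add: word_scale_single sum_of_words)
qed

lemma inj_word: "inj_on (word :: 'a list \<Rightarrow> ('a list \<Rightarrow>\<^sub>0 'k::field)) S"
proof (rule inj_onI)
  fix u v assume "word u = (word v :: 'a list \<Rightarrow>\<^sub>0 'k)"
  then have "Poly_Mapping.keys (word u :: 'a list \<Rightarrow>\<^sub>0 'k) = Poly_Mapping.keys (word v :: 'a list \<Rightarrow>\<^sub>0 'k)"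
    by simp
  then show "u = v" by simp
qed

lemma independent_words: "word_space.independent (word ` S :: ('a list \<Rightarrow>\<^sub>0 'k::field) set)"
proof -
  have "word u \<notin> word_space.span (word ` S - {word u} :: ('a list \<Rightarrow>\<^sub>0 'k) set)" for u
  proof -
    have "word ` S - {word u} = (word ` (S - {u}) :: ('a list \<Rightarrow>\<^sub>0 'k) set)"
      using inj_word[of UNIV] by (auto simp: inj_on_def)
    then show ?thesis by (simp add: span_words supported_def)
  qed
  then show ?thesis unfolding word_space.dependent_def by blast
qed

lemma dim_supported:
  "word_space.dim (supported S :: ('a list \<Rightarrow>\<^sub>0 'k::field) set) = card S"
proof -
  have "word_space.dim (word_space.span (word ` S) :: ('a list \<Rightarrow>\<^sub>0 'k) set) = card (word ` S :: ('a list \<Rightarrow>\<^sub>0 'k) set)"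
    by (rule word_space.dim_span_eq_card_independent[OF independent_words])
  then show ?thesis by (simp add: span_words card_image inj_word)
qed

text \<open>
  A finite-dimensional space involves only finitely many words.
\<close>
lemma finite_span_supported:
  fixes B :: "('a list \<Rightarrow>\<^sub>0 'k::field) set"
  assumes "finite B"
  obtains n where "word_space.span B \<subseteq> supported {u. length u < n}"
proof
  define n where "n = Suc (Max (insert 0 (length ` (\<Union>b\<in>B. Poly_Mapping.keys b))))"
  have "length u < n" if "b \<in> B" "u \<in> Poly_Mapping.keys b" for b u
    using that assms unfolding n_def less_Suc_eq_le by (intro Max_ge) auto
  then show "word_space.span B \<subseteq> supported {u. length u < n}"
    by (intro word_space.span_minimal subspace_supported) (auto simp: supported_def)
qed

text \<open>
  The defining sum ranges over the supports of the two arguments, which change under addition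
  and scaling. Summing over larger common index sets makes bilinearity visible.
\<close>
lemma monomial_mult_expand:
  assumes "finite S" "finite T" "Poly_Mapping.keys f \<subseteq> S" "Poly_Mapping.keys g \<subseteq> T"
  shows "monomial_mult X f g = (\<Sum>u\<in>S. \<Sum>v\<in>T.
    if u @ v \<in> factors X
    then Poly_Mapping.single (u @ v) (Poly_Mapping.lookup f u * Poly_Mapping.lookup g v) else 0)"
proof -
  have "(\<Sum>v\<in>Poly_Mapping.keys g. if u @ v \<in> factors X
      then Poly_Mapping.single (u @ v) (Poly_Mapping.lookup f u * Poly_Mapping.lookup g v) else 0)
    = (\<Sum>v\<in>T. if u @ v \<in> factors X
      then Poly_Mapping.single (u @ v) (Poly_Mapping.lookup f u * Poly_Mapping.lookup g v) else 0)" for u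
    using assms by (intro sum.mono_neutral_left) (auto simp: in_keys_iff)
  then show ?thesis
    unfolding monomial_mult_def
    using assms by (simp add: in_keys_iff) (intro sum.mono_neutral_left ballI sum.neutral, auto simp: in_keys_iff)
qed

lemma monomial_mult_add_left:
  "monomial_mult X (f + g) h = monomial_mult X f h + monomial_mult X g h"
proof -
  let ?S = "Poly_Mapping.keys f \<union> Poly_Mapping.keys g" and ?T = "Poly_Mapping.keys h"
  have "Poly_Mapping.keys (f + g) \<subseteq> ?S" by (rule keys_add)
  then show ?thesis
    by (subst (1 2 3) monomial_mult_expand[of ?S ?T])
      (auto simp: lookup_add single_add distrib_right simp flip: sum.distrib intro!: sum.cong)
qed

lemma monomial_mult_add_right:
  "monomial_mult X h (f + g) = monomial_mult X h f + monomial_mult X h g"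
proof -
  let ?S = "Poly_Mapping.keys f \<union> Poly_Mapping.keys g" and ?T = "Poly_Mapping.keys h"
  have "Poly_Mapping.keys (f + g) \<subseteq> ?S" by (rule keys_add)
  then show ?thesis
    by (subst (1 2 3) monomial_mult_expand[of ?T ?S])
      (auto simp: lookup_add single_add distrib_left simp flip: sum.distrib intro!: sum.cong)
qed

lemma monomial_mult_scale:
  "monomial_mult X (word_scale c f) g = word_scale c (monomial_mult X f g)"
  "monomial_mult X f (word_scale c g) = word_scale c (monomial_mult X f g)"
  by (subst (1 2) monomial_mult_expand[of "Poly_Mapping.keys f" "Poly_Mapping.keys g"];
    auto simp: keys_word_scale word_space.scale_sum_right word_scale_single mult_ac intro!: sum.cong)+

lemma monomial_mult_single:
  "monomial_mult X (Poly_Mapping.single u a) (Poly_Mapping.single v b) =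
    (if u @ v \<in> factors X then Poly_Mapping.single (u @ v) (a * b) else 0)"
  by (subst monomial_mult_expand[of "{u}" "{v}"]) simp_all

lemma monomial_mult_zero [simp]: "monomial_mult X 0 f = 0" "monomial_mult X f 0 = 0"
  by (simp_all add: monomial_mult_def)

text \<open>
  On words both sides are the concatenation \<open>u @ v @ w\<close> if it is a factor and \<open>0\<close> otherwise: a
  factor has only factors as subwords, so no intermediate product vanishes too early.
\<close>
lemma monomial_mult_assoc:
  "monomial_mult X (monomial_mult X f g) h = monomial_mult X f (monomial_mult X g h)"
proof (induction f rule: additive_word_induct)
  case (single u a)
  show ?case
  proof (induction g rule: additive_word_induct)
    case (single v b)
    show ?case
    proof (induction h rule: additive_word_induct)
      case (single w c)
      show ?case
        using factors_append[of u v X] factors_append[of "u @ v" w X] factors_append[of u "v @ w" X]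
        by (auto simp: monomial_mult_single mult.assoc)
    qed (simp_all add: monomial_mult_add_right)
  qed (simp_all add: monomial_mult_add_left monomial_mult_add_right)
qed (simp_all add: monomial_mult_add_left)

lemma monomial_mult_one:
  assumes "f \<in> supported (factors X)"
  shows "monomial_mult X monomial_one f = f" "monomial_mult X f monomial_one = f"
proof -
  have "monomial_mult X monomial_one f = (\<Sum>u\<in>Poly_Mapping.keys f. Poly_Mapping.single u (Poly_Mapping.lookup f u))"
    using assms by (subst monomial_mult_expand[of "{[]}" "Poly_Mapping.keys f"])
      (auto simp: monomial_one_def supported_def intro!: sum.cong)
  then show "monomial_mult X monomial_one f = f" by (simp add: sum_of_words)
  have "monomial_mult X f monomial_one = (\<Sum>u\<in>Poly_Mapping.keys f. Poly_Mapping.single u (Poly_Mapping.lookup f u))"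
    using assms by (subst monomial_mult_expand[of "Poly_Mapping.keys f" "{[]}"])
      (auto simp: monomial_one_def supported_def intro!: sum.cong)
  then show "monomial_mult X f monomial_one = f" by (simp add: sum_of_words)
qed

lemma monomial_mult_supported:
  assumes "f \<in> supported S" "g \<in> supported T"
    "\<And>u v. u \<in> S \<Longrightarrow> v \<in> T \<Longrightarrow> u @ v \<in> factors X \<Longrightarrow> u @ v \<in> R"
  shows "monomial_mult X f g \<in> supported R"
  unfolding monomial_mult_def
proof (intro word_space.subspace_sum[OF subspace_supported])
  fix u v assume "u \<in> Poly_Mapping.keys f" "v \<in> Poly_Mapping.keys g"
  then show "(if u @ v \<in> factors X then Poly_Mapping.single (u @ v)
      (Poly_Mapping.lookup f u * Poly_Mapping.lookup g v) else 0) \<in> supported R"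
    using assms by (auto simp: supported_def)
qed

text \<open>
  Words of different lengths do not interact, so each coefficient of \<open>a\<close> is seen by exactly
  one component. This forces the components, hence gives uniqueness of the decomposition.
\<close>
lemma homogeneous_components_unique:
  assumes "\<And>n. f n \<in> monomial_component X n" "finite {n. f n \<noteq> 0}" "a = (\<Sum>n | f n \<noteq> 0. f n)"
  shows "Poly_Mapping.lookup (f n) w = (if length w = n then Poly_Mapping.lookup a w else 0)"
proof -
  have zero: "Poly_Mapping.lookup (f m) w = 0" if "m \<noteq> length w" for m
    using that assms(1)[of m] by (auto simp: monomial_component_def in_keys_iff)
  have "Poly_Mapping.lookup a w = (\<Sum>m | f m \<noteq> 0. Poly_Mapping.lookup (f m) w)"
    by (simp add: assms(3) lookup_sum)
  also have "\<dots> = (\<Sum>m | f m \<noteq> 0. if m = length w then Poly_Mapping.lookup (f (length w)) w else 0)"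
    using zero by (intro sum.cong) auto
  also have "\<dots> = Poly_Mapping.lookup (f (length w)) w"
    using assms(2) by (auto simp: sum.delta)
  finally show ?thesis using zero by auto
qed

lemma homogeneous_decomposition:
  fixes a :: "'a list \<Rightarrow>\<^sub>0 'k::field"
  assumes "a \<in> monomial_algebra X"
  shows "\<exists>!f. (\<forall>n. f n \<in> monomial_component X n) \<and> finite {n. f n \<noteq> 0} \<and> a = (\<Sum>n | f n \<noteq> 0. f n)"
proof (rule ex_ex1I)
  define f where "f n = (\<Sum>u | u \<in> Poly_Mapping.keys a \<and> length u = n.
    Poly_Mapping.single u (Poly_Mapping.lookup a u))" for n
  have "f n \<in> monomial_component X n" for n
    unfolding f_def monomial_component_eq
    by (intro word_space.subspace_sum[OF subspace_supported])
      (use assms in \<open>auto simp: supported_def monomial_algebra_def words_def\<close>)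
  moreover have fin: "{n. f n \<noteq> 0} \<subseteq> length ` Poly_Mapping.keys a"
  proof
    fix n assume "n \<in> {n. f n \<noteq> 0}"
    then have "{u. u \<in> Poly_Mapping.keys a \<and> length u = n} \<noteq> {}"
      unfolding f_def by (metis (mono_tags, lifting) mem_Collect_eq sum.empty)
    then show "n \<in> length ` Poly_Mapping.keys a" by auto
  qed
  moreover have "a = (\<Sum>n | f n \<noteq> 0. f n)"
  proof -
    have "(\<Sum>n | f n \<noteq> 0. f n) = (\<Sum>n\<in>length ` Poly_Mapping.keys a. f n)"
      using fin by (intro sum.mono_neutral_left) auto
    also have "\<dots> = (\<Sum>u\<in>Poly_Mapping.keys a. Poly_Mapping.single u (Poly_Mapping.lookup a u))"
      unfolding f_def by (simp add: sum.image_gen[symmetric])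
    finally show ?thesis by (simp add: sum_of_words)
  qed
  ultimately show "\<exists>f. (\<forall>n. f n \<in> monomial_component X n) \<and> finite {n. f n \<noteq> 0} \<and> a = (\<Sum>n | f n \<noteq> 0. f n)"
    by (intro exI[of _ f] conjI allI) (auto intro: finite_subset)
next
  fix f g :: "nat \<Rightarrow> 'a list \<Rightarrow>\<^sub>0 'k"
  assume "(\<forall>n. f n \<in> monomial_component X n) \<and> finite {n. f n \<noteq> 0} \<and> a = (\<Sum>n | f n \<noteq> 0. f n)"
    and "(\<forall>n. g n \<in> monomial_component X n) \<and> finite {n. g n \<noteq> 0} \<and> a = (\<Sum>n | g n \<noteq> 0. g n)"
  then have "Poly_Mapping.lookup (f n) w = Poly_Mapping.lookup (g n) w" for n w
    using homogeneous_components_unique[of f X a n w] homogeneous_components_unique[of g X a n w]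
    by simp
  then show "f = g" by (intro ext poly_mapping_eqI)
qed

lemma graded_algebra_monomial:
  assumes "[] \<in> factors X"
  shows "graded_algebra (word_scale :: 'k::field \<Rightarrow> ('a list \<Rightarrow>\<^sub>0 'k) \<Rightarrow> _)
    (monomial_algebra X) (monomial_mult X) monomial_one (monomial_component X)"
proof (unfold_locales, goal_cases)
  case 13 then show ?case by (rule homogeneous_decomposition)
next
  case (15 a m b n)
  then show ?case
    unfolding monomial_component_eq by (rule monomial_mult_supported) (auto simp: words_def)
qed (use assms in \<open>auto simp: monomial_algebra_eq monomial_component_eq subspace_supported
      monomial_mult_add_left monomial_mult_add_right monomial_mult_scale monomial_mult_assoc
      monomial_mult_one words_def word_in_supported[of "[]", folded monomial_one_def]
      intro: monomial_mult_supported subsetD[OF supported_mono, rotated]\<close>)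

section \<open>Projective simplicity\<close>

context finite_minimal_subshift
begin

text \<open>
  By uniform recurrence all long words contain \<open>q\<close> and therefore lie in the ideal, so the
  finitely many short words span the quotient.
\<close>
lemma finite_codim_if_contains_word:
  fixes I :: "('a list \<Rightarrow>\<^sub>0 'k::field) set"
  assumes I: "algebra_over.ideal word_scale (monomial_algebra X) (monomial_mult X) I"
    and q: "q \<in> factors X" "word q \<in> I"
  shows "algebra_over.finite_codim word_scale (monomial_algebra X) I"
proof -
  interpret alg: graded_algebra "word_scale :: 'k \<Rightarrow> ('a list \<Rightarrow>\<^sub>0 'k) \<Rightarrow> _"
    "monomial_algebra X" "monomial_mult X" monomial_one "monomial_component X"
    by (rule graded_algebra_monomial[OF Nil_factor])
  obtain R where R: "\<And>v. v \<in> factors X \<Longrightarrow> R \<le> length v \<Longrightarrow> sublist q v"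
    using uniform_recurrence[OF q(1)] by blast
  have long: "word v \<in> I" if v: "v \<in> factors X" "R \<le> length v" for v
  proof -
    obtain p s where v_eq: "v = p @ q @ s" using R[OF v] by (auto simp: sublist_def)
    have pF: "p \<in> factors X" "p @ q \<in> factors X" "s \<in> factors X"
      using v(1) factors_append[of p "q @ s"] factors_append[of "p @ q" s] by (auto simp: v_eq)
    have "monomial_mult X (word p) (word q) \<in> I"
      using I q(2) word_in_supported[OF pF(1)]
      unfolding alg.ideal_def unfolding monomial_algebra_eq by blast
    then have "monomial_mult X (monomial_mult X (word p) (word q)) (word s) \<in> I"
      using I word_in_supported[OF pF(3)]
      unfolding alg.ideal_def unfolding monomial_algebra_eq by blast
    then show ?thesis
      using v(1) pF(2) by (simp add: monomial_mult_single v_eq)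
  qed
  define F where "F = (word ` {u \<in> factors X. length u < R} :: ('a list \<Rightarrow>\<^sub>0 'k) set)"
  have "word ` factors X \<subseteq> I \<union> F"
  proof (intro image_subsetI)
    fix u assume "u \<in> factors X"
    then show "word u \<in> I \<union> F"
      using long[of u] by (cases "length u < R") (simp_all add: F_def)
  qed
  then have "monomial_algebra X \<subseteq> word_space.span (I \<union> F)"
    unfolding monomial_algebra_eq span_words[symmetric] by (rule word_space.span_mono)
  moreover have "finite F" "F \<subseteq> monomial_algebra X"
    by (auto simp: F_def finite_words_less monomial_algebra_eq intro: word_in_supported)
  ultimately show ?thesis unfolding alg.finite_codim_def by blast
qed

text \<open>
  A prefix that isolates one word \<open>z\<close> in the support of \<open>f\<close> annihilates all other terms of \<open>f\<close>
  under left multiplication and leaves a non-zero multiple of a single word.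
\<close>
lemma ideal_contains_word:
  fixes I :: "('a list \<Rightarrow>\<^sub>0 'k::field) set"
  assumes I: "algebra_over.ideal word_scale (monomial_algebra X) (monomial_mult X) I"
    and f: "f \<in> I" "f \<in> monomial_component X n" "f \<noteq> 0"
  obtains q where "q \<in> factors X" "word q \<in> I"
proof -
  interpret alg: graded_algebra "word_scale :: 'k \<Rightarrow> ('a list \<Rightarrow>\<^sub>0 'k) \<Rightarrow> _"
    "monomial_algebra X" "monomial_mult X" monomial_one "monomial_component X"
    by (rule graded_algebra_monomial[OF Nil_factor])
  have keys: "Poly_Mapping.keys f \<noteq> {}" "Poly_Mapping.keys f \<subseteq> words X n"
    using f by (auto simp: monomial_component_eq supported_def)
  obtain p z where pz: "z \<in> Poly_Mapping.keys f" "p @ z \<in> factors X"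
    and uniq: "\<And>z'. z' \<in> Poly_Mapping.keys f \<Longrightarrow> p @ z' \<in> factors X \<Longrightarrow> z' = z"
    using isolating_prefix[OF _ keys] by (metis finite_keys)
  let ?c = "Poly_Mapping.lookup f z"
  have "monomial_mult X (word p) f = (\<Sum>u\<in>Poly_Mapping.keys f.
      if p @ u \<in> factors X then Poly_Mapping.single (p @ u) (Poly_Mapping.lookup f u) else 0)"
    by (subst monomial_mult_expand[of "{p}" "Poly_Mapping.keys f"]) (auto intro!: sum.cong)
  also have "\<dots> = (\<Sum>u\<in>Poly_Mapping.keys f. if u = z then Poly_Mapping.single (p @ z) ?c else 0)"
  proof (intro sum.cong refl)
    fix u assume "u \<in> Poly_Mapping.keys f"
    then show "(if p @ u \<in> factors X then Poly_Mapping.single (p @ u) (Poly_Mapping.lookup f u) else 0)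
        = (if u = z then Poly_Mapping.single (p @ z) ?c else 0)"
      using uniq[of u] pz(2) by (cases "u = z") auto
  qed
  also have "\<dots> = Poly_Mapping.single (p @ z) ?c"
    using pz(1) by (simp add: sum.delta)
  finally have "Poly_Mapping.single (p @ z) ?c \<in> I"
    using I f(1) word_in_supported[OF factors_append(1)[OF pz(2)]]
    unfolding alg.ideal_def unfolding monomial_algebra_eq by metis
  then have "word_scale (inverse ?c) (Poly_Mapping.single (p @ z) ?c) \<in> I"
    using I unfolding alg.ideal_def by (blast intro: word_space.subspace_scale)
  then have "word (p @ z) \<in> I"
    using pz(1) by (simp add: word_scale_single in_keys_iff)
  with pz(2) show thesis by (rule that)
qed

lemma not_fin_dim_monomial_algebra:
  "\<not> word_space.fin_dim_subspace (monomial_algebra X :: ('a list \<Rightarrow>\<^sub>0 'k::field) set)"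
proof
  assume "word_space.fin_dim_subspace (monomial_algebra X :: ('a list \<Rightarrow>\<^sub>0 'k::field) set)"
  then obtain B :: "('a list \<Rightarrow>\<^sub>0 'k) set" where B: "finite B" "monomial_algebra X = word_space.span B"
    unfolding word_space.fin_dim_subspace_def by blast
  obtain n where "word_space.span B \<subseteq> supported {u. length u < n}"
    using finite_span_supported[OF B(1)] by blast
  moreover obtain u where "u \<in> words X n" using words_nonempty by blast
  then have "word u \<in> word_space.span B" "\<not> length u < n"
    using B(2) word_in_supported[of u "factors X"] by (auto simp: words_def monomial_algebra_eq)
  ultimately show False by (auto simp: supported_def)
qed

lemma monomial_algebra_projectively_simple:
  "graded_algebra.projectively_simple (word_scale :: 'k::field \<Rightarrow> ('a list \<Rightarrow>\<^sub>0 'k) \<Rightarrow> _)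
    (monomial_algebra X) (monomial_mult X) (monomial_component X)"
proof -
  interpret alg: graded_algebra "word_scale :: 'k \<Rightarrow> ('a list \<Rightarrow>\<^sub>0 'k) \<Rightarrow> _"
    "monomial_algebra X" "monomial_mult X" monomial_one "monomial_component X"
    by (rule graded_algebra_monomial[OF Nil_factor])
  show ?thesis
    unfolding alg.projectively_simple_def
  proof (intro conjI allI impI not_fin_dim_monomial_algebra)
    fix I :: "('a list \<Rightarrow>\<^sub>0 'k) set"
    assume I: "alg.homogeneous_ideal I \<and> I \<noteq> {0}"
    then have ideal: "alg.ideal I" and eq: "I = word_space.span (\<Union>n. I \<inter> monomial_component X n)"
      unfolding alg.homogeneous_ideal_def by blast+
    have "\<exists>n. \<exists>f\<in>I \<inter> monomial_component X n. f \<noteq> 0"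
    proof (rule ccontr)
      assume "\<nexists>n. \<exists>f\<in>I \<inter> monomial_component X n. f \<noteq> 0"
      then have "(\<Union>n. I \<inter> monomial_component X n) \<subseteq> {0}" by blast
      then have "word_space.span (\<Union>n. I \<inter> monomial_component X n) \<subseteq> {0}"
        by (rule word_space.span_minimal) (rule word_space.subspace_single_0)
      then have "I \<subseteq> {0}" using eq by simp
      moreover have "0 \<in> I" using ideal unfolding alg.ideal_def by (blast intro: word_space.subspace_0)
      ultimately show False using I by blast
    qed
    then obtain q where "q \<in> factors X" "word q \<in> I"
      using ideal_contains_word[OF ideal] by (metis IntD1 IntD2)
    then show "alg.finite_codim I" by (rule finite_codim_if_contains_word[OF ideal])
  qed
qed

end

section \<open>Exponential growth\<close>

lemma subadditive_mult_bound:
  fixes a :: "nat \<Rightarrow> real"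
  assumes "\<And>m n. a (m + n) \<le> a m + a n"
  shows "a (q * m + r) \<le> real q * a m + a r"
proof (induction q)
  case (Suc q)
  have "a (Suc q * m + r) \<le> a m + a (q * m + r)"
    using assms[of m "q * m + r"] by (simp add: algebra_simps)
  with Suc show ?case by (simp add: algebra_simps)
qed simp

text \<open>
  Fekete's lemma. Division with remainder \<open>n = q * m + r\<close> gives
  \<open>a n / n \<le> a m / m + C / n\<close> with \<open>C\<close> depending only on \<open>m\<close>, so the quotients eventually come
  close to their infimum.
\<close>
lemma subadditive_quotient_tendsto_Inf:
  fixes a :: "nat \<Rightarrow> real"
  assumes subadd: "\<And>m n. a (m + n) \<le> a m + a n" and nonneg: "\<And>n. 0 \<le> a n"
  shows "(\<lambda>n. a n / real n) \<longlonglongrightarrow> (INF n\<in>{1..}. a n / real n)"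
proof (rule tendstoI)
  let ?h = "INF n\<in>{1..}. a n / real n"
  fix \<epsilon> :: real assume "\<epsilon> > 0"
  have bdd: "bdd_below ((\<lambda>n. a n / real n) ` {1..})"
    by (rule bdd_belowI[of _ 0]) (use nonneg in auto)
  have lower: "?h \<le> a n / real n" if "n \<ge> 1" for n
    using that by (intro cINF_lower[OF bdd]) auto
  obtain m where m: "m \<ge> 1" "a m / real m < ?h + \<epsilon> / 2"
    using cINF_less_iff[OF _ bdd, of "?h + \<epsilon> / 2"] \<open>\<epsilon> > 0\<close> by auto
  define C where "C = Max (a ` {..<m})"
  have upper: "a n / real n \<le> a m / real m + C / real n" if "n \<ge> 1" for n
  proof -
    have "a n \<le> real (n div m) * a m + a (n mod m)"
      using subadditive_mult_bound[OF subadd, of "n div m" m "n mod m"] by simp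
    also have "a (n mod m) \<le> C" unfolding C_def using m(1) by (intro Max_ge) auto
    also have "real (n div m) * a m \<le> (real n / real m) * a m"
      using nonneg m(1) by (intro mult_right_mono of_nat_div_le_of_nat)
    finally show ?thesis using that m(1) by (simp add: field_simps)
  qed
  have "(\<lambda>n. C / real n) \<longlonglongrightarrow> 0" by (rule lim_const_over_n)
  then have "\<forall>\<^sub>F n in sequentially. C / real n < \<epsilon> / 2"
    by (rule order_tendstoD) (use \<open>\<epsilon> > 0\<close> in simp)
  then show "\<forall>\<^sub>F n in sequentially. dist (a n / real n) ?h < \<epsilon>"
    using eventually_ge_at_top[of 1]
  proof eventually_elim
    case (elim n)
    have "a n / real n < ?h + \<epsilon>" using elim upper[of n] m(2) by linarith
    then show ?case using elim lower[of n] unfolding dist_real_def by linarith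
  qed
qed

context finite_minimal_subshift
begin

lemma complexity_pos: "complexity X n > 0"
  by (simp add: complexity_eq card_gt_0_iff finite_words words_nonempty)

lemma complexity_submultiplicative: "complexity X (m + n) \<le> complexity X m * complexity X n"
proof -
  have "inj_on (\<lambda>w. (take m w, drop m w)) (words X (m + n))"
    by (rule inj_onI) (metis append_take_drop_id prod.inject)
  moreover have "(\<lambda>w. (take m w, drop m w)) ` words X (m + n) \<subseteq> words X m \<times> words X n"
    using factors_append[of "take m w" "drop m w" X for w] by (auto simp: words_def)
  ultimately have "card (words X (m + n)) \<le> card (words X m \<times> words X n)"
    by (rule card_inj_on_le) (simp add: finite_words)
  then show ?thesis by (simp add: complexity_eq card_cartesian_product)
qed

text \<open>
  The logarithm of the complexity is subadditive. Hence the limit in the definition of the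
  entropy exists and is the infimum of the quotients, which gives a lower bound for every \<open>n\<close>
  and not only asymptotically.
\<close>
lemma complexity_ge_exp_entropy: "exp (entropy X) ^ n \<le> real (complexity X n)"
proof (cases "n = 0")
  case True
  then show ?thesis using complexity_pos[of 0] by simp
next
  case False
  define a where "a n = ln (real (complexity X n))" for n
  have "a (m + n) \<le> a m + a n" for m n
  proof -
    have "real (complexity X (m + n)) \<le> real (complexity X m) * real (complexity X n)"
      using complexity_submultiplicative by (simp flip: of_nat_mult)
    then have "a (m + n) \<le> ln (real (complexity X m) * real (complexity X n))"
      unfolding a_def using complexity_pos by (subst ln_le_cancel_iff) auto
    then show ?thesis using complexity_pos by (simp add: a_def ln_mult)
  qed
  moreover have nonneg: "0 \<le> a n" for n
    unfolding a_def using complexity_pos[of n] by (intro ln_ge_zero) simp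
  ultimately have "(\<lambda>n. a n / real n) \<longlonglongrightarrow> (INF n\<in>{1..}. a n / real n)"
    by (rule subadditive_quotient_tendsto_Inf)
  then have "entropy X = (INF n\<in>{1..}. a n / real n)"
    by (simp add: entropy_def a_def limI)
  also have "\<dots> \<le> a n / real n"
    using False nonneg by (intro cINF_lower bdd_belowI[of _ 0]) auto
  finally have "real n * entropy X \<le> a n" using False by (simp add: field_simps)
  then have "exp (real n * entropy X) \<le> exp (a n)" by simp
  also have "exp (a n) = real (complexity X n)" using complexity_pos[of n] by (simp add: a_def)
  finally show ?thesis by (simp add: exp_of_nat_mult)
qed

text \<open>
  The space spanned by the empty word and the letters generates the algebra. Multiplying by it
  prolongs words by at most one letter, and every factor of length \<open>n + 1\<close> arises in this way from
  its prefix of length \<open>n\<close>.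
\<close>
lemma space_power_short_words:
  "algebra_over.space_power (word_scale :: 'k::field \<Rightarrow> ('a list \<Rightarrow>\<^sub>0 'k) \<Rightarrow> _) (monomial_mult X) monomial_one
     (supported {u \<in> factors X. length u < 2}) n = supported {u \<in> factors X. length u < Suc n}"
proof -
  interpret alg: graded_algebra "word_scale :: 'k \<Rightarrow> ('a list \<Rightarrow>\<^sub>0 'k) \<Rightarrow> _"
    "monomial_algebra X" "monomial_mult X" monomial_one "monomial_component X"
    by (rule graded_algebra_monomial[OF Nil_factor])
  define S where "S n = {u \<in> factors X. length u < n}" for n
  have "alg.space_power (supported (S 2)) n = supported (S (Suc n))"
  proof (induction n)
    case 0
    have "S (Suc 0) = {[]}" using Nil_factor by (auto simp: S_def)
    then show ?case
      using span_words[of "{[]}", where 'k='k] by (simp, simp add: monomial_one_def)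
  next
    case (Suc n)
    have "word_space.span {monomial_mult X l v | l v. l \<in> supported (S (Suc n)) \<and> v \<in> supported (S 2)}
        = (supported (S (Suc (Suc n))) :: ('a list \<Rightarrow>\<^sub>0 'k) set)"
    proof (intro equalityI word_space.span_minimal subspace_supported)
      show "{monomial_mult X l v | l v. l \<in> supported (S (Suc n)) \<and> v \<in> supported (S 2)}
          \<subseteq> (supported (S (Suc (Suc n))) :: ('a list \<Rightarrow>\<^sub>0 'k) set)"
        by (auto intro!: monomial_mult_supported simp: S_def)
      have "word u \<in> {monomial_mult X l v | l v. l \<in> supported (S (Suc n)) \<and> v \<in> supported (S 2)}"
        if "u \<in> S (Suc (Suc n))" for u
      proof -
        define l where "l = take n u"
        define r where "r = drop n u"
        have u: "u = l @ r" by (simp add: l_def r_def)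
        then have "l \<in> S (Suc n)" "r \<in> S 2" "u \<in> factors X"
          using that factors_append[of l r X] by (auto simp: S_def l_def r_def)
        moreover have "word u = monomial_mult X (word l) (word r)"
          using \<open>u \<in> factors X\<close> by (simp add: monomial_mult_single u)
        ultimately show ?thesis using word_in_supported by blast
      qed
      then show "supported (S (Suc (Suc n))) \<subseteq> word_space.span
          {monomial_mult X l v | l v. l \<in> supported (S (Suc n)) \<and> v \<in> (supported (S 2) :: ('a list \<Rightarrow>\<^sub>0 'k) set)}"
        unfolding span_words[symmetric]
        by (intro word_space.span_mono) (auto simp: span_words)
    qed
    then show ?case by (simp add: Suc word_space.span_prod_def)
  qed
  then show ?thesis by (simp add: S_def)
qed

lemma monomial_algebra_exponential_growth:
  assumes "entropy X > 0"
  shows "algebra_over.exponential_growth (word_scale :: 'k::field \<Rightarrow> ('a list \<Rightarrow>\<^sub>0 'k) \<Rightarrow> _)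
    (monomial_algebra X) (monomial_mult X) monomial_one"
proof -
  interpret alg: graded_algebra "word_scale :: 'k \<Rightarrow> ('a list \<Rightarrow>\<^sub>0 'k) \<Rightarrow> _"
    "monomial_algebra X" "monomial_mult X" monomial_one "monomial_component X"
    by (rule graded_algebra_monomial[OF Nil_factor])
  define V where "V = (supported {u \<in> factors X. length u < 2} :: ('a list \<Rightarrow>\<^sub>0 'k) set)"
  have power: "alg.space_power V n = supported {u \<in> factors X. length u < Suc n}" for n
    unfolding V_def by (rule space_power_short_words)
  have "alg.generating_subspace V"
    unfolding alg.generating_subspace_def
  proof (intro conjI)
    show "word_space.fin_dim_subspace V"
      unfolding word_space.fin_dim_subspace_def V_def span_words[symmetric]
      using finite_words_less by blast
    show "V \<subseteq> monomial_algebra X"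
      unfolding V_def monomial_algebra_eq by (rule supported_mono) auto
    show "monomial_one \<in> V"
      using Nil_factor by (auto simp: V_def monomial_one_def intro: word_in_supported)
    have "f \<in> (\<Union>n. alg.space_power V n)" if "f \<in> monomial_algebra X" for f
    proof -
      obtain n where "word_space.span {f} \<subseteq> supported {u. length u < n}"
        using finite_span_supported[of "{f}"] by blast
      then have "f \<in> supported {u. length u < n}" using word_space.span_base[of f "{f}"] by blast
      then have "f \<in> alg.space_power V n"
        using that unfolding power monomial_algebra_eq supported_def by fastforce
      then show ?thesis by blast
    qed
    moreover have "alg.space_power V n \<subseteq> monomial_algebra X" for n
      unfolding power monomial_algebra_eq by (rule supported_mono) auto
    ultimately show "(\<Union>n. alg.space_power V n) = monomial_algebra X" by blast
  qed
  moreover have "exp (entropy X) ^ n \<le> real (word_space.dim (alg.space_power V n))" for n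
  proof -
    have "complexity X n \<le> card {u \<in> factors X. length u < Suc n}"
      unfolding complexity_eq by (rule card_mono[OF finite_words_less]) (auto simp: words_def)
    then show ?thesis
      using complexity_ge_exp_entropy[of n] unfolding power dim_supported by linarith
  qed
  moreover have "exp (entropy X) > 1" using assms by simp
  ultimately show ?thesis
    unfolding alg.exponential_growth_def by (auto intro!: exI[of _ V] exI[of _ "exp (entropy X)"])
qed

end

section \<open>Dimension estimates and linear extension in modules\<close>

context vector_space
begin

lemma dim_le_dim_of_finite:
  assumes "S \<subseteq> span T" "finite T"
  shows "dim S \<le> dim T"
proof -
  obtain B where B: "B \<subseteq> T" "independent B" "T \<subseteq> span B" "card B = dim T"
    using basis_exists by blast
  have "S \<subseteq> span B" using assms(1) B(3) span_minimal subspace_span by blast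
  then have "dim S \<le> card B" using B(1) assms(2) by (intro dim_le_card) (auto intro: finite_subset)
  with B(4) show ?thesis by simp
qed

lemma dim_Un_le_dim_add_card:
  assumes "finite S" "finite T"
  shows "dim (S \<union> T) \<le> dim S + card T"
proof -
  obtain B where B: "B \<subseteq> S" "independent B" "S \<subseteq> span B" "card B = dim S"
    using basis_exists by blast
  have "S \<union> T \<subseteq> span (B \<union> T)"
    using B(3) span_mono[of B "B \<union> T"] span_superset[of "B \<union> T"] by blast
  moreover have fin: "finite B" using B(1) assms(1) by (rule finite_subset)
  ultimately have "dim (S \<union> T) \<le> card (B \<union> T)" using assms(2) by (intro dim_le_card) auto
  also have "\<dots> \<le> card B + card T" by (rule card_Un_le)
  finally show ?thesis using B(4) by simp
qed

lemma span_prod_mono: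
  assumes "L \<subseteq> L'" "V \<subseteq> V'"
  shows "span_prod p L V \<subseteq> span_prod p L' V'"
  unfolding span_prod_def by (rule span_mono) (use assms in blast)

end

context right_module
begin

lemma act_zero_right [simp]: "m \<in> M \<Longrightarrow> act m 0 = 0"
  using act_scale_right[of m one 0] A.one_closed by simp

lemma act_zero_left [simp]: "a \<in> A \<Longrightarrow> act 0 a = 0"
  using act_scale_left[of 0 a 0] M.subspace_0[OF subspace_M] by simp

text \<open>
  Submodule and invariance conditions are checked on spanning sets; this lemma treats the module
  argument of the action and the next one the algebra argument.
\<close>
lemma act_span_in_span:
  assumes "P \<subseteq> M" "a \<in> A" "\<And>p. p \<in> P \<Longrightarrow> act p a \<in> M.span Q" "x \<in> M.span P"
  shows "act x a \<in> M.span Q"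
proof -
  have "M.subspace {x \<in> M. act x a \<in> M.span Q}"
    using subspace_M assms(2)
    by (intro M.subspaceI) (auto simp: act_add_left act_scale_left M.subspace_0 M.subspace_add
        M.subspace_scale M.span_zero M.span_add M.span_scale)
  then have "M.span P \<subseteq> {x \<in> M. act x a \<in> M.span Q}"
    using assms(1,3) by (intro M.span_minimal) auto
  with assms(4) show ?thesis by blast
qed

lemma act_in_span_span:
  assumes "S \<subseteq> A" "m \<in> M" "\<And>s. s \<in> S \<Longrightarrow> act m s \<in> M.span Q" "a \<in> A.span S"
  shows "act m a \<in> M.span Q"
proof -
  have "A.subspace {a \<in> A. act m a \<in> M.span Q}"
    using A.subspace_A assms(2)
    by (intro A.subspaceI) (auto simp: act_add_right act_scale_right A.subspace_0 A.subspace_add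
        A.subspace_scale M.span_zero M.span_add M.span_scale)
  then have "A.span S \<subseteq> {a \<in> A. act m a \<in> M.span Q}"
    using assms(1,3) by (intro A.span_minimal) auto
  with assms(4) show ?thesis by blast
qed

lemma span_prod_spans_subset:
  assumes "P \<subseteq> M" "S \<subseteq> A" "\<And>p s. p \<in> P \<Longrightarrow> s \<in> S \<Longrightarrow> act p s \<in> M.span Q"
  shows "M.span_prod act (M.span P) (A.span S) \<subseteq> M.span Q"
  unfolding M.span_prod_def
proof (rule M.span_minimal)
  show "{act l v |l v. l \<in> M.span P \<and> v \<in> A.span S} \<subseteq> M.span Q"
  proof clarify
    fix l v assume l: "l \<in> M.span P" and v: "v \<in> A.span S"
    have "v \<in> A" using A.span_minimal[OF assms(2) A.subspace_A] v by blast
    then show "act l v \<in> M.span Q"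
    proof (rule act_span_in_span[OF assms(1) _ _ l])
      fix p assume "p \<in> P"
      with assms show "act p v \<in> M.span Q"
        by (intro act_in_span_span[OF assms(2) _ _ v]) auto
    qed
  qed
qed (rule M.subspace_span)

end

section \<open>Exhaustive amenability of modules\<close>

text \<open>
  The linear bound is the dimension of a space swept out along a path of \<open>n * K\<close> letters, the
  exponential bound what \<open>K\<close> growth steps by the factor \<open>1 + \<delta>\<close> would produce.
\<close>
lemma linear_less_exponential:
  fixes \<delta> :: real
  assumes "\<delta> > 0"
  obtains K :: nat where "real (n * K + 1) < (1 + \<delta>) ^ K"
proof -
  define x where "x = inverse (1 + \<delta>)"
  have x: "0 < x" "x < 1" using assms by (simp_all add: x_def inverse_less_1_iff)
  have "(\<lambda>K. real n * (real K * x ^ K) + x ^ K) \<longlonglongrightarrow> real n * 0 + 0"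
    using x by (intro tendsto_intros powser_times_n_limit_0 LIMSEQ_realpow_zero) auto
  then have "\<forall>\<^sub>F K in sequentially. real n * (real K * x ^ K) + x ^ K < 1"
    by (rule order_tendstoD) simp
  then obtain K where "real n * (real K * x ^ K) + x ^ K < 1"
    by (auto simp: eventually_sequentially)
  then have "real (n * K + 1) * x ^ K < 1" by (simp add: algebra_simps)
  moreover have "(1 + \<delta>) ^ K > 0" using assms by simp
  moreover have "x ^ K * (1 + \<delta>) ^ K = 1" using assms by (simp add: x_def flip: power_mult_distrib)
  ultimately have "real (n * K + 1) < (1 + \<delta>) ^ K"
    by (metis mult.assoc mult.right_neutral mult_less_cancel_right_pos mult_1)
  then show thesis by (rule that)
qed

text \<open>
  If every step grew by the factor \<open>1 + \<delta>\<close>, then \<open>d K\<close> would be at least \<open>(1 + \<delta>) ^ K * d 0\<close>.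
\<close>
lemma exists_slow_step:
  fixes d :: "nat \<Rightarrow> real"
  assumes "\<delta> \<ge> 0" "d K < (1 + \<delta>) ^ K * d 0"
  shows "\<exists>k<K. d (Suc k) < (1 + \<delta>) * d k"
proof (rule ccontr)
  assume fast: "\<not> (\<exists>k<K. d (Suc k) < (1 + \<delta>) * d k)"
  have "(1 + \<delta>) ^ k * d 0 \<le> d k" if "k \<le> K" for k
    using that
  proof (induction k)
    case (Suc k)
    then have "(1 + \<delta>) * ((1 + \<delta>) ^ k * d 0) \<le> (1 + \<delta>) * d k"
      using assms(1) by (intro mult_left_mono) auto
    also have "\<dots> \<le> d (Suc k)" using fast Suc.prems by (meson Suc_le_lessD not_less)
    finally show ?case by (simp add: mult.assoc)
  qed simp
  from this[of K] assms(2) show False by simp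
qed

locale monomial_module =
  finite_minimal_subshift \<Sigma> X +
  right_module word_scale "monomial_algebra X" "monomial_mult X" monomial_one scaleM M act
  for \<Sigma> :: "'a set" and X
    and scaleM :: "'k::field \<Rightarrow> 'm::ab_group_add \<Rightarrow> 'm" and M act
begin

abbreviation act_word :: "'m \<Rightarrow> 'a list \<Rightarrow> 'm" where
  "act_word m u \<equiv> act m (word u)"

lemma word_in_algebra: "u \<in> factors X \<Longrightarrow> word u \<in> monomial_algebra X"
  by (simp add: monomial_algebra_eq word_in_supported)

lemma act_word_closed: "m \<in> M \<Longrightarrow> u \<in> factors X \<Longrightarrow> act_word m u \<in> M"
  by (simp add: act_closed word_in_algebra)

lemma act_word_Nil: "m \<in> M \<Longrightarrow> act_word m [] = m"
  using act_one by (simp add: monomial_one_def)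

lemma act_word_append:
  assumes "m \<in> M" "u \<in> factors X" "v \<in> factors X"
  shows "act_word (act_word m u) v = (if u @ v \<in> factors X then act_word m (u @ v) else 0)"
  using act_mult[OF assms(1) word_in_algebra word_in_algebra, OF assms(2,3)] assms(1)
  by (simp add: monomial_mult_single split: if_splits)

lemma subspace_in_short_words:
  assumes "word_space.fin_dim_subspace V" "V \<subseteq> monomial_algebra X"
  obtains n where "V \<subseteq> word_space.span (word ` {u \<in> factors X. length u < n})"
proof -
  obtain B where "finite B" "V = word_space.span B"
    using assms(1) unfolding word_space.fin_dim_subspace_def by blast
  then obtain n where "V \<subseteq> supported {u. length u < n}"
    using finite_span_supported by blast
  with assms(2) have "V \<subseteq> word_space.span (word ` {u \<in> factors X. length u < n})"
    unfolding span_words monomial_algebra_eq by (auto simp: supported_def)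
  then show thesis by (rule that)
qed

text \<open>
  Suppose \<open>M w\<close> is finite-dimensional, spanned by \<open>B\<close>. Every long word has the form \<open>a @ w @ s\<close>
  with \<open>s\<close> of bounded length, and it maps \<open>M\<close> into \<open>M w s\<close>, which is contained in the span of the
  finitely many translates of \<open>B\<close> by short words. Together with the
  translates of \<open>W\<close> by short words these span a finite-dimensional submodule, and a non-zero
  finite-dimensional submodule is invariant for every \<open>\<epsilon>\<close>.
\<close>
lemma invariant_subspace_if_spanned:
  assumes w: "w \<in> factors X"
    and B: "finite B" "B \<subseteq> (\<lambda>m. act_word m w) ` M" "(\<lambda>m. act_word m w) ` M \<subseteq> M.span B"
    and V: "V \<subseteq> monomial_algebra X" and "\<epsilon> > 0"
    and W: "finite W" "W \<subseteq> M" and "M \<noteq> {0}"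
  shows "\<exists>L. invariant_subspace V \<epsilon> L \<and> M.span W \<subseteq> L"
proof -
  obtain m0 where m0: "m0 \<in> M" "m0 \<noteq> 0"
    using \<open>M \<noteq> {0}\<close> M.subspace_0[OF subspace_M] by blast
  obtain R where R: "\<And>v. v \<in> factors X \<Longrightarrow> R \<le> length v \<Longrightarrow> sublist w v"
    using uniform_recurrence[OF w] by blast
  \<comment> \<open>The vector \<open>m0\<close> makes the submodule non-zero even if \<open>W\<close> is \<open>{}\<close> or \<open>{0}\<close>.\<close>
  define G where "G = insert m0 (W \<union> B)"
  define L where "L = (\<lambda>(g, b). act_word g b) ` (G \<times> {b \<in> factors X. length b < Suc R})"
  have BM: "B \<subseteq> M" using B(2) w by (auto simp: act_word_closed)
  then have GM: "G \<subseteq> M" using W(2) m0(1) by (auto simp: G_def)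
  have L_I: "act_word g b \<in> L" if "g \<in> G" "b \<in> factors X" "length b < Suc R" for g b
    using that by (auto simp: L_def)
  have fin: "finite L"
    using W(1) B(1) finite_words_less by (simp add: L_def G_def)
  have LM: "L \<subseteq> M" using GM by (auto simp: L_def act_word_closed)
  have GL: "G \<subseteq> L"
  proof
    fix g assume "g \<in> G"
    then show "g \<in> L" using L_I[of g "[]"] GM by (auto simp: Nil_factor act_word_Nil)
  qed
  have long: "act_word m u \<in> M.span L" if m: "m \<in> M" and u: "u \<in> factors X" "Suc R \<le> length u" for m u
  proof -
    define c where "c = drop (length u - R) u"
    have uc: "u = take (length u - R) u @ c" by (simp add: c_def)
    have "c \<in> factors X" using u(1) uc factors_append(2) by metis
    moreover have c_len: "length c = R" using u(2) by (simp add: c_def)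
    ultimately obtain p s where "c = p @ w @ s" using R[of c] by (auto simp: sublist_def)
    then obtain a where u_eq: "u = a @ w @ s" and s_len: "length s < Suc R"
      using uc c_len by (metis append.assoc le_add2 le_imp_less_Suc length_append trans_le_add2)
    have F: "a \<in> factors X" "a @ w \<in> factors X" "s \<in> factors X"
      using u(1) factors_append[of a "w @ s" X] factors_append[of "a @ w" s X] by (auto simp: u_eq)
    have "act_word (act_word (act_word m a) w) s = act_word m u"
      using m u(1) F w by (simp add: act_word_append u_eq)
    moreover have "act_word (act_word m a) w \<in> M.span B"
      using B(3) act_word_closed[OF m F(1)] by blast
    then have "act_word (act_word (act_word m a) w) s \<in> M.span L"
    proof (rule act_span_in_span[OF BM word_in_algebra[OF F(3)], rotated])
      fix b assume "b \<in> B"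
      then show "act_word b s \<in> M.span L"
        using F(3) s_len by (intro M.span_base L_I) (simp_all add: G_def)
    qed
    ultimately show ?thesis by simp
  qed
  have "act_word l v \<in> M.span L" if l: "l \<in> L" and v: "v \<in> factors X" for l v
  proof -
    obtain g b where g: "g \<in> G" "b \<in> factors X" "length b < Suc R" "l = act_word g b"
      using l by (auto simp: L_def)
    have gM: "g \<in> M" using g(1) GM by blast
    show ?thesis
    proof (cases "b @ v \<in> factors X")
      case True
      then have "act_word l v = act_word g (b @ v)" using gM g v by (simp add: act_word_append)
      also have "\<dots> \<in> M.span L"
      proof (cases "length (b @ v) < Suc R")
        case True
        then show ?thesis using L_I[OF g(1) \<open>b @ v \<in> factors X\<close>] by (simp add: M.span_base)
      next
        case False
        then show ?thesis using long[OF gM \<open>b @ v \<in> factors X\<close>] by simp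
      qed
      finally show ?thesis .
    next
      case False
      then show ?thesis using gM g v by (simp add: act_word_append M.span_zero)
    qed
  qed
  then have "M.span_prod act (M.span L) (word_space.span (word ` factors X)) \<subseteq> M.span L"
    using LM word_in_algebra by (intro span_prod_spans_subset) auto
  then have "M.span_prod act (M.span L) V \<subseteq> M.span L"
    using V M.span_prod_mono[of "M.span L" "M.span L" V "monomial_algebra X" act]
    by (auto simp: span_words monomial_algebra_eq)
  then have "M.dim (M.span_prod act (M.span L) V) \<le> M.dim L"
    using fin by (intro M.dim_le_dim_of_finite) auto
  moreover have "M.dim L > 0"
  proof -
    have "M.independent {m0}" using m0(2) by (simp add: M.dependent_single)
    then have "M.dim {m0} = 1" by (simp add: M.dim_eq_card_independent)
    moreover have "M.dim {m0} \<le> M.dim L"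
      using GL fin by (intro M.dim_le_dim_of_finite) (auto simp: G_def intro: M.span_base)
    ultimately show ?thesis by simp
  qed
  ultimately have "real (M.dim (M.span_prod act (M.span L) V)) < (1 + \<epsilon>) * real (M.dim (M.span L))"
    using mult_pos_pos[OF \<open>\<epsilon> > 0\<close>, of "real (M.dim L)"] by (simp add: distrib_right)
  moreover have "M.span L \<subseteq> M" using LM subspace_M by (rule M.span_minimal)
  moreover have "M.fin_dim_subspace (M.span L)" using fin unfolding M.fin_dim_subspace_def by blast
  moreover have "M.span W \<subseteq> M.span L" using GL by (intro M.span_mono) (auto simp: G_def)
  ultimately show ?thesis unfolding invariant_subspace_def by blast
qed

text \<open>
  Choose a word \<open>p\<close> that has only one prolongation \<open>z\<close> by \<open>n * K\<close> letters. As \<open>M p\<close> is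
  infinite-dimensional, it contains an independent set \<open>F\<close> of any prescribed size \<open>D\<close>. Words applied
  to \<open>F\<close> can only move along \<open>z\<close>: let \<open>L k\<close> be the union of the translates of \<open>F\<close> by the prefixes of
  \<open>z\<close> of length at most \<open>n * k\<close>. Then \<open>V\<close> maps the span of \<open>L k\<close> into that of \<open>L (Suc k)\<close>, while the
  dimension of \<open>L K\<close> is at most \<open>D * (n * K + 1)\<close>. So the dimension cannot grow by the factor
  \<open>1 + \<epsilon> / 2\<close> in each of \<open>K\<close> steps, and some \<open>L k\<close> spans an almost invariant space. Since \<open>z\<close> is chosen before
  \<open>D\<close>, the size \<open>D\<close> may be taken so large that adjoining \<open>W\<close> costs only another \<open>\<epsilon> / 2\<close>.
\<close>
lemma invariant_subspace_if_not_spanned: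
  assumes infinite: "\<And>w B. w \<in> factors X \<Longrightarrow> finite B \<Longrightarrow> B \<subseteq> (\<lambda>m. act_word m w) ` M \<Longrightarrow>
      \<not> (\<lambda>m. act_word m w) ` M \<subseteq> M.span B"
    and V: "V \<subseteq> word_space.span (word ` {u \<in> factors X. length u < n})" and "\<epsilon> > 0"
    and W: "finite W" "W \<subseteq> M"
  shows "\<exists>L. invariant_subspace V \<epsilon> L \<and> M.span W \<subseteq> L"
proof -
  define S where "S = {u \<in> factors X. length u < n}"
  have finS: "finite S" by (simp add: S_def finite_words_less)
  define \<delta> where "\<delta> = \<epsilon> / 2"
  have \<delta>: "\<delta> > 0" using \<open>\<epsilon> > 0\<close> by (simp add: \<delta>_def)
  obtain K where K: "real (n * K + 1) < (1 + \<delta>) ^ K"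
    using linear_less_exponential[OF \<delta>] by blast
  obtain p z where z: "z \<in> words X (n * K)" "p @ z \<in> factors X"
    and unique: "\<And>z'. z' \<in> words X (n * K) \<Longrightarrow> p @ z' \<in> factors X \<Longrightarrow> z' = z"
    using isolating_prefix[OF finite_words words_nonempty subset_refl] by metis
  have zF: "take j z \<in> factors X" for j
    using z(1) factors_append(1)[of "take j z" "drop j z"] by (simp add: words_def)
  have pF: "p \<in> factors X" using z(2) by (rule factors_append)
  \<comment> \<open>A word that continues \<open>p @ take j z\<close> follows \<open>z\<close>, since it can be prolonged to the full length of \<open>z\<close>.\<close>
  have forced: "take j z @ v = take (j + length v) z"
    if F: "p @ take j z @ v \<in> factors X" and len: "j + length v \<le> n * K" for j v
  proof -
    obtain t where t: "(p @ take j z @ v) @ t \<in> factors X" "length t = n * K - (j + length v)"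
      using factor_extend[OF F] by blast
    have take_len: "length (take j z) = j" using z(1) len by (simp add: words_def)
    then have "take j z @ v @ t \<in> words X (n * K)"
      using t len z(1) factors_append(2)[of p "take j z @ v @ t" X]
      by (simp add: words_def del: length_take)
    then have "take j z @ v @ t = z" by (rule unique) (use t(1) in simp)
    then have "take (j + length v) z = take (j + length v) (take j z @ v @ t)" by simp
    also have "\<dots> = take j z @ v" using take_len by (simp del: length_take)
    finally show ?thesis by simp
  qed
  \<comment> \<open>An upper bound for the dimension of the space that \<open>V\<close> makes out of \<open>W\<close>.\<close>
  define C where "C = card W * card S"
  define D where "D = Suc (nat \<lceil>real C / \<delta>\<rceil>)"
  have D: "real C \<le> \<delta> * real D"
  proof -
    have "real C / \<delta> \<le> real D" unfolding D_def by linarith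
    then show ?thesis using \<delta> by (simp add: field_simps)
  qed
  obtain F where F: "F \<subseteq> (\<lambda>m. act_word m p) ` M" "finite F" "card F = D" "M.independent F"
  proof -
    obtain B where B: "B \<subseteq> (\<lambda>m. act_word m p) ` M" "M.independent B" "(\<lambda>m. act_word m p) ` M \<subseteq> M.span B"
      using M.maximal_independent_subset by blast
    then have "infinite B" using infinite[OF pF] by blast
    then obtain F where "F \<subseteq> B" "finite F" "card F = D" by (meson infinite_arbitrarily_large)
    then show thesis using B(1) M.independent_mono[OF B(2)] by (intro that[of F]) auto
  qed
  have FM: "F \<subseteq> M" using F(1) pF by (auto simp: act_word_closed)
  define L where "L k = (\<lambda>(f, j). act_word f (take j z)) ` (F \<times> {..n * k})" for k
  have L_I: "act_word f (take j z) \<in> L k" if "f \<in> F" "j \<le> n * k" for f j k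
    using that by (auto simp: L_def)
  have finL: "finite (L k)" for k using F(2) by (simp add: L_def)
  have LM: "L k \<subseteq> M" for k using FM zF by (auto simp: L_def act_word_closed)
  have step: "act_word l v \<in> M.span (L (Suc k))" if l: "l \<in> L k" and v: "v \<in> S" and "k < K" for l v k
  proof -
    obtain f j where f: "f \<in> F" "j \<le> n * k" "l = act_word f (take j z)" using l by (auto simp: L_def)
    obtain m where m: "m \<in> M" "f = act_word m p" using f(1) F(1) by blast
    have "n * Suc k \<le> n * K" using \<open>k < K\<close> by (intro mult_le_mono) auto
    then have len: "j + length v \<le> n * Suc k" "j + length v \<le> n * K"
      using f(2) v by (auto simp: S_def)
    have vF: "v \<in> factors X" using v by (simp add: S_def)
    have pz: "p @ take j z \<in> factors X"
      using z(2) factors_append(1)[of "p @ take j z" "drop j z"] by simp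
    have l_eq: "l = act_word m (p @ take j z)"
      using m pz by (simp add: f(3) act_word_append pF zF)
    show ?thesis
    proof (cases "p @ take j z @ v \<in> factors X")
      case True
      have "act_word l v = act_word m (p @ take j z @ v)"
        using True m(1) pz vF by (simp add: l_eq act_word_append)
      also have "\<dots> = act_word m (p @ take (j + length v) z)"
        using forced[OF True len(2)] by simp
      also have "\<dots> = act_word f (take (j + length v) z)"
        using True forced[OF True len(2)] m pF zF by (simp add: act_word_append)
      also have "\<dots> \<in> L (Suc k)" using f(1) len(1) by (rule L_I)
      finally show ?thesis by (rule M.span_base)
    next
      case False
      then show ?thesis using m(1) pz vF by (simp add: l_eq act_word_append M.span_zero)
    qed
  qed
  have L0: "F \<subseteq> L k" for k
  proof
    fix f assume "f \<in> F"
    then show "f \<in> L k" using L_I[of f 0 k] FM by (auto simp: act_word_Nil)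
  qed
  have dim_F: "M.dim F = D" using F(3,4) by (simp add: M.dim_eq_card_independent)
  have dim_L: "D \<le> M.dim (L k)" for k
    unfolding dim_F[symmetric] using L0 finL by (intro M.dim_le_dim_of_finite) (auto intro: M.span_base)
  have "real (M.dim (L K)) < (1 + \<delta>) ^ K * real (M.dim (L 0))"
  proof -
    have "M.dim (L K) \<le> card (L K)" using finL by (intro M.dim_le_card) (auto intro: M.span_base)
    also have "\<dots> \<le> card (F \<times> {..n * K})" unfolding L_def using F(2) by (intro card_image_le) simp
    also have "\<dots> = D * (n * K + 1)" by (simp add: card_cartesian_product F(3))
    finally have "real (M.dim (L K)) \<le> real D * real (n * K + 1)" by (metis of_nat_le_iff of_nat_mult)
    also have "\<dots> < real D * (1 + \<delta>) ^ K" using K by (intro mult_strict_left_mono) (auto simp: D_def)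
    also have "\<dots> \<le> real (M.dim (L 0)) * (1 + \<delta>) ^ K"
      using dim_L \<delta> by (intro mult_right_mono) auto
    finally show ?thesis by (simp add: mult.commute)
  qed
  then obtain k where k: "k < K" "real (M.dim (L (Suc k))) < (1 + \<delta>) * real (M.dim (L k))"
    using exists_slow_step[of \<delta> "\<lambda>k. real (M.dim (L k))" K] \<delta> by auto
  define Q where "Q = (\<lambda>(x, v). act_word x v) ` (W \<times> S)"
  have finQ: "finite Q" using W(1) finS by (simp add: Q_def)
  have cardQ: "card Q \<le> C"
    unfolding Q_def C_def card_cartesian_product[symmetric] using W(1) finS by (intro card_image_le) simp
  have "M.span_prod act (M.span (L k \<union> W)) (word_space.span (word ` S)) \<subseteq> M.span (L (Suc k) \<union> Q)"
  proof (rule span_prod_spans_subset)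
    show "L k \<union> W \<subseteq> M" using LM W(2) by blast
    show "word ` S \<subseteq> monomial_algebra X" by (auto simp: S_def word_in_algebra)
    fix x a assume x: "x \<in> L k \<union> W" and "a \<in> (word ` S :: ('a list \<Rightarrow>\<^sub>0 'k) set)"
    then obtain v where v: "v \<in> S" "a = word v" by blast
    show "act x a \<in> M.span (L (Suc k) \<union> Q)"
    proof (cases "x \<in> L k")
      case True
      then have "act x a \<in> M.span (L (Suc k))" using step v k(1) by blast
      then show ?thesis using M.span_mono[of "L (Suc k)" "L (Suc k) \<union> Q"] by blast
    next
      case False
      then have "act x a \<in> Q" using x v by (auto simp: Q_def)
      then show ?thesis by (simp add: M.span_base)
    qed
  qed
  moreover have "M.span_prod act (M.span (L k \<union> W)) V
      \<subseteq> M.span_prod act (M.span (L k \<union> W)) (word_space.span (word ` S))"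
    using V by (intro M.span_prod_mono) (auto simp: S_def)
  ultimately have "M.dim (M.span_prod act (M.span (L k \<union> W)) V) \<le> M.dim (L (Suc k) \<union> Q)"
    using finL finQ by (intro M.dim_le_dim_of_finite) auto
  also have "\<dots> \<le> M.dim (L (Suc k)) + card Q" using finL finQ by (intro M.dim_Un_le_dim_add_card)
  finally have "real (M.dim (M.span_prod act (M.span (L k \<union> W)) V)) \<le> real (M.dim (L (Suc k))) + real C"
    using cardQ by linarith
  also have "\<dots> < (1 + \<delta>) * real (M.dim (L k)) + \<delta> * real D" using k(2) D by linarith
  also have "\<dots> \<le> (1 + \<delta>) * real (M.dim (L k)) + \<delta> * real (M.dim (L k))"
    using dim_L \<delta> by (intro add_left_mono mult_left_mono) auto
  also have "\<dots> = (1 + \<epsilon>) * real (M.dim (L k))" by (simp add: \<delta>_def algebra_simps)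
  also have "\<dots> \<le> (1 + \<epsilon>) * real (M.dim (M.span (L k \<union> W)))"
  proof -
    have "M.dim (L k) \<le> M.dim (L k \<union> W)"
      using finL W(1) by (intro M.dim_le_dim_of_finite) (auto intro: M.span_base)
    then show ?thesis using \<open>\<epsilon> > 0\<close> by (intro mult_left_mono) auto
  qed
  finally have "real (M.dim (M.span_prod act (M.span (L k \<union> W)) V))
      < (1 + \<epsilon>) * real (M.dim (M.span (L k \<union> W)))" .
  moreover have "M.span (L k \<union> W) \<subseteq> M"
    using LM W(2) subspace_M by (intro M.span_minimal) auto
  moreover have "M.fin_dim_subspace (M.span (L k \<union> W))"
    using finL W(1) unfolding M.fin_dim_subspace_def by blast
  moreover have "M.span W \<subseteq> M.span (L k \<union> W)" by (intro M.span_mono) auto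
  ultimately show ?thesis unfolding invariant_subspace_def by blast
qed

lemma monomial_module_exhaustively_amenable:
  assumes "M \<noteq> {0}"
  shows exhaustively_amenable
  unfolding exhaustively_amenable_def
proof (intro allI impI, elim conjE)
  fix V :: "('a list \<Rightarrow>\<^sub>0 'k) set" and \<epsilon> W0
  assume V: "word_space.fin_dim_subspace V" "V \<subseteq> monomial_algebra X" and \<epsilon>: "(\<epsilon>::real) > 0"
    and "M.fin_dim_subspace W0" "W0 \<subseteq> M"
  then obtain W where W: "finite W" "W0 = M.span W" "W \<subseteq> M"
    unfolding M.fin_dim_subspace_def using M.span_superset by blast
  obtain n where n: "V \<subseteq> word_space.span (word ` {u \<in> factors X. length u < n})"
    using subspace_in_short_words[OF V] by blast
  show "\<exists>L. invariant_subspace V \<epsilon> L \<and> W0 \<subseteq> L"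
  proof (cases "\<exists>w\<in>factors X. \<exists>B. finite B \<and> B \<subseteq> (\<lambda>m. act_word m w) ` M \<and>
      (\<lambda>m. act_word m w) ` M \<subseteq> M.span B")
    case True
    then show ?thesis
      using invariant_subspace_if_spanned[OF _ _ _ _ V(2) \<epsilon> W(1,3) assms] W(2) by metis
  next
    case False
    then show ?thesis
      using invariant_subspace_if_not_spanned[OF _ n \<epsilon> W(1,3)] W(2) by metis
  qed
qed

end

section \<open>The monomial algebra of a minimal subshift of positive entropy\<close>

theorem corollary4p2:
  fixes \<Sigma> :: "'a set" and X :: "(int \<Rightarrow> 'a) set"
  assumes "finite \<Sigma>" and "minimal_subshift \<Sigma> X" and "entropy X > 0"
  shows
    "graded_algebra (word_scale :: 'k::field \<Rightarrow> ('a list \<Rightarrow>\<^sub>0 'k) \<Rightarrow> _)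
        (monomial_algebra X) (monomial_mult X) monomial_one (monomial_component X) \<and>
     graded_algebra.projectively_simple (word_scale :: 'k \<Rightarrow> ('a list \<Rightarrow>\<^sub>0 'k) \<Rightarrow> _)
        (monomial_algebra X) (monomial_mult X) (monomial_component X) \<and>
     algebra_over.exponential_growth (word_scale :: 'k \<Rightarrow> ('a list \<Rightarrow>\<^sub>0 'k) \<Rightarrow> _)
        (monomial_algebra X) (monomial_mult X) monomial_one \<and>
     (\<forall>(scaleM :: 'k \<Rightarrow> 'm::ab_group_add \<Rightarrow> 'm) M act.
        right_module (word_scale :: 'k \<Rightarrow> ('a list \<Rightarrow>\<^sub>0 'k) \<Rightarrow> _)
          (monomial_algebra X) (monomial_mult X) monomial_one scaleM M act \<and> M \<noteq> {0} \<longrightarrow>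
        right_module.exhaustively_amenable (word_scale :: 'k \<Rightarrow> ('a list \<Rightarrow>\<^sub>0 'k) \<Rightarrow> _)
          (monomial_algebra X) scaleM M act)"
proof -
  interpret finite_minimal_subshift \<Sigma> X
    using assms by unfold_locales
  have "right_module.exhaustively_amenable (word_scale :: 'k \<Rightarrow> ('a list \<Rightarrow>\<^sub>0 'k) \<Rightarrow> _)
      (monomial_algebra X) scaleM M act"
    if module: "right_module (word_scale :: 'k \<Rightarrow> ('a list \<Rightarrow>\<^sub>0 'k) \<Rightarrow> _)
        (monomial_algebra X) (monomial_mult X) monomial_one scaleM M act" and "M \<noteq> {0}"
    for scaleM :: "'k \<Rightarrow> 'm \<Rightarrow> 'm" and M act
  proof -
    have "monomial_module \<Sigma> X scaleM M act"
      using finite_minimal_subshift_axioms module by (rule monomial_module.intro)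
    then show ?thesis
      using \<open>M \<noteq> {0}\<close> by (rule monomial_module.monomial_module_exhaustively_amenable)
  qed
  then show ?thesis
    using graded_algebra_monomial[OF Nil_factor] monomial_algebra_projectively_simple
      monomial_algebra_exponential_growth[OF assms(3)]
    by blast
qed

end
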